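(* Let $M$ be a monoid subsemigroup of an $E$-unitary inverse monoid $F$ (equivalently, of a semidirect product $Y\rtimes G$ with $Y$ a semilattice with identity and $G$ a group acting on $Y$ by monoid morphisms). Let $E=E(F)$, and for $x\in F$ put $x^+=xx^{-1}$ and $x^*=x^{-1}x$. Then: - if $t,x\in M$ and $e=tx$ satisfies $e=e^2\in E$, then $e=t^+x^*$; - if $t,x,y,w\in M$ with $tx\in E$ and $xw=yw$, then $ty\in E$; - for all $a,b\in M$, all $i\ge0$ and all $x,y\in M$, if $xba^i=yba^i$ and $x^*ba^i=ba^i$, then $y^*ba^i=ba^i$. Consequently, if there are elements $a,b\in M$ and idempotents $e_i\in E(M)$ for $i\ge1$ such that (i) $b,ba,ba^2,\ldots$ are pairwise incomparable under the $\leq_{\mathcal L}$-order of $F$, and (ii) for each $i\ge1$, $e_iba^i=ba^i$ and $e_iba^{i-1}\ne ba^{i-1}$, then $M$ is not left coherent.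
   Context: $E(S)$ denotes the set of idempotents of $S$. An inverse monoid $F$ is $E$-unitary if $e,\,ae\in E(F)$ implies $a\in E(F)$ (for $a \in F$). A monoid subsemigroup of $F$ is a subsemigroup that is itself a monoid (its identity need not be that of $F$). The preorder $\leq_{\mathcal L}$ on $F$ is $u\leq_{\mathcal L}v$ iff $Fu\subseteq Fv$. The semidirect product $Y\rtimes G$ is $Y\times G$ with product $(y,g)(z,h)=(y\wedge g z,gh)$. By convention $ba^0=b$. A left $S$-act over a monoid $S$ is a set with a unital associative left action of $S$. It is finitely presented if it is isomorphic to a quotient of a free left $S$-act on a finite set by a finitely generated left $S$-act congruence. $S$ is left coherent if every finitely generated subact of every finitely presented left $S$-act is finitely presented. *)

theory Defs
  imports "HOL-Algebra.Group" "HOL-Algebra.Coset"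
begin

section \<open>Inverse monoids\<close>

definition idempotents :: "('a, 'm) monoid_scheme \<Rightarrow> 'a set" where
  "idempotents S = {e \<in> carrier S. e \<otimes>\<^bsub>S\<^esub> e = e}"

definition is_sinv :: "('a, 'm) monoid_scheme \<Rightarrow> 'a \<Rightarrow> 'a \<Rightarrow> bool" where
  "is_sinv S x y \<longleftrightarrow> y \<in> carrier S
     \<and> x \<otimes>\<^bsub>S\<^esub> y \<otimes>\<^bsub>S\<^esub> x = x \<and> y \<otimes>\<^bsub>S\<^esub> x \<otimes>\<^bsub>S\<^esub> y = y"

locale inverse_monoid = monoid S for S (structure) +
  assumes ex1_sinv: "x \<in> carrier S \<Longrightarrow> \<exists>!y. is_sinv S x y"

text \<open>The inverse in the sense of inverse semigroups; the library's \<open>m_inv\<close> is the inverse of a unit.\<close>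

definition sinv :: "('a, 'm) monoid_scheme \<Rightarrow> 'a \<Rightarrow> 'a" where
  "sinv S x = (THE y. is_sinv S x y)"

definition plus_idem :: "('a, 'm) monoid_scheme \<Rightarrow> 'a \<Rightarrow> 'a" where
  "plus_idem S x = x \<otimes>\<^bsub>S\<^esub> sinv S x"

definition star_idem :: "('a, 'm) monoid_scheme \<Rightarrow> 'a \<Rightarrow> 'a" where
  "star_idem S x = sinv S x \<otimes>\<^bsub>S\<^esub> x"

locale E_unitary_inverse_monoid = inverse_monoid +
  assumes E_unitary:
    "\<lbrakk>a \<in> carrier S; e \<in> idempotents S; a \<otimes> e \<in> idempotents S\<rbrakk> \<Longrightarrow> a \<in> idempotents S"

definition le_L :: "('a, 'm) monoid_scheme \<Rightarrow> 'a \<Rightarrow> 'a \<Rightarrow> bool" where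
  "le_L S x y \<longleftrightarrow> carrier S #>\<^bsub>S\<^esub> x \<subseteq> carrier S #>\<^bsub>S\<^esub> y"

text \<open>A monoid subsemigroup \<open>M\<close> has its own identity \<open>u\<close>, which may differ from \<open>\<one>\<^bsub>S\<^esub>\<close>.\<close>

abbreviation restrict_monoid ::
    "('a, 'm) monoid_scheme \<Rightarrow> 'a set \<Rightarrow> 'a \<Rightarrow> ('a, 'm) monoid_scheme" where
  "restrict_monoid S M u \<equiv> S\<lparr>carrier := M, one := u\<rparr>"

definition monoid_subsemigroup :: "('a, 'm) monoid_scheme \<Rightarrow> 'a set \<Rightarrow> 'a \<Rightarrow> bool" where
  "monoid_subsemigroup S M u \<longleftrightarrow> M \<subseteq> carrier S \<and> monoid (restrict_monoid S M u)"


section \<open>Semidirect products of a semilattice with identity and a group\<close>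

text \<open>A semilattice with identity is a commutative monoid of idempotents, its product being the meet.\<close>

locale semilattice_action = Y: comm_monoid Y + G: group G
  for Y :: "('y, 'm) monoid_scheme" and G :: "('g, 'n) monoid_scheme"
    and \<alpha> :: "'g \<Rightarrow> 'y \<Rightarrow> 'y" +
  assumes idem: "y \<in> carrier Y \<Longrightarrow> y \<otimes>\<^bsub>Y\<^esub> y = y"
    and act_hom: "g \<in> carrier G \<Longrightarrow> \<alpha> g \<in> hom Y Y"
    and act_hom_one: "g \<in> carrier G \<Longrightarrow> \<alpha> g \<one>\<^bsub>Y\<^esub> = \<one>\<^bsub>Y\<^esub>"
    and act_one: "y \<in> carrier Y \<Longrightarrow> \<alpha> \<one>\<^bsub>G\<^esub> y = y"
    and act_mult: "\<lbrakk>g \<in> carrier G; h \<in> carrier G; y \<in> carrier Y\<rbrakk>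
      \<Longrightarrow> \<alpha> (g \<otimes>\<^bsub>G\<^esub> h) y = \<alpha> g (\<alpha> h y)"

definition semidirect ::
    "('y, 'm) monoid_scheme \<Rightarrow> ('g, 'n) monoid_scheme \<Rightarrow> ('g \<Rightarrow> 'y \<Rightarrow> 'y) \<Rightarrow> ('y \<times> 'g) monoid" where
  "semidirect Y G \<alpha> =
     \<lparr>carrier = carrier Y \<times> carrier G,
      mult = (\<lambda>(y, g) (z, h). (y \<otimes>\<^bsub>Y\<^esub> \<alpha> g z, g \<otimes>\<^bsub>G\<^esub> h)),
      one = (\<one>\<^bsub>Y\<^esub>, \<one>\<^bsub>G\<^esub>)\<rparr>"


section \<open>Left acts and left coherence\<close>

locale left_act = monoid S for S (structure) and A :: "'x set" and act :: "'a \<Rightarrow> 'x \<Rightarrow> 'x" +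
  assumes act_closed: "\<lbrakk>s \<in> carrier S; x \<in> A\<rbrakk> \<Longrightarrow> act s x \<in> A"
    and act_unit: "x \<in> A \<Longrightarrow> act \<one> x = x"
    and act_assoc: "\<lbrakk>s \<in> carrier S; t \<in> carrier S; x \<in> A\<rbrakk> \<Longrightarrow> act (s \<otimes> t) x = act s (act t x)"

definition subact ::
    "('a, 'm) monoid_scheme \<Rightarrow> 'x set \<Rightarrow> ('a \<Rightarrow> 'x \<Rightarrow> 'x) \<Rightarrow> 'x set \<Rightarrow> bool" where
  "subact S A act B \<longleftrightarrow> B \<subseteq> A \<and> (\<forall>s\<in>carrier S. \<forall>x\<in>B. act s x \<in> B)"

definition generated_subact ::
    "('a, 'm) monoid_scheme \<Rightarrow> 'x set \<Rightarrow> ('a \<Rightarrow> 'x \<Rightarrow> 'x) \<Rightarrow> 'x set \<Rightarrow> 'x set" where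
  "generated_subact S A act X = \<Inter>{B. subact S A act B \<and> X \<subseteq> B}"

definition fg_subact ::
    "('a, 'm) monoid_scheme \<Rightarrow> 'x set \<Rightarrow> ('a \<Rightarrow> 'x \<Rightarrow> 'x) \<Rightarrow> 'x set \<Rightarrow> bool" where
  "fg_subact S A act B \<longleftrightarrow> (\<exists>X. finite X \<and> X \<subseteq> A \<and> B = generated_subact S A act X)"

definition act_congruence ::
    "('a, 'm) monoid_scheme \<Rightarrow> 'x set \<Rightarrow> ('a \<Rightarrow> 'x \<Rightarrow> 'x) \<Rightarrow> ('x \<times> 'x) set \<Rightarrow> bool" where
  "act_congruence S A act \<rho> \<longleftrightarrow>
     equiv A \<rho> \<and> (\<forall>s\<in>carrier S. \<forall>(x, y)\<in>\<rho>. (act s x, act s y) \<in> \<rho>)"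

definition generated_congruence ::
    "('a, 'm) monoid_scheme \<Rightarrow> 'x set \<Rightarrow> ('a \<Rightarrow> 'x \<Rightarrow> 'x) \<Rightarrow> ('x \<times> 'x) set \<Rightarrow> ('x \<times> 'x) set" where
  "generated_congruence S A act H = \<Inter>{\<rho>. act_congruence S A act \<rho> \<and> H \<subseteq> \<rho>}"

definition fg_congruence ::
    "('a, 'm) monoid_scheme \<Rightarrow> 'x set \<Rightarrow> ('a \<Rightarrow> 'x \<Rightarrow> 'x) \<Rightarrow> ('x \<times> 'x) set \<Rightarrow> bool" where
  "fg_congruence S A act \<rho> \<longleftrightarrow>
     (\<exists>H. finite H \<and> H \<subseteq> A \<times> A \<and> \<rho> = generated_congruence S A act H)"

text \<open>The induced action on the quotient \<open>A // \<rho>\<close>.\<close>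

definition quotient_act :: "('x \<times> 'x) set \<Rightarrow> ('a \<Rightarrow> 'x \<Rightarrow> 'x) \<Rightarrow> 'a \<Rightarrow> 'x set \<Rightarrow> 'x set" where
  "quotient_act \<rho> act s C = (\<Union>x\<in>C. \<rho> `` {act s x})"

text \<open>The free left act on a set \<open>X\<close> has carrier \<open>carrier S \<times> X\<close> and this action.\<close>

definition free_act :: "('a, 'm) monoid_scheme \<Rightarrow> 'a \<Rightarrow> 'a \<times> 'i \<Rightarrow> 'a \<times> 'i" where
  "free_act S s = (\<lambda>(t, i). (s \<otimes>\<^bsub>S\<^esub> t, i))"

definition act_iso ::
    "('a, 'm) monoid_scheme \<Rightarrow> 'x set \<Rightarrow> ('a \<Rightarrow> 'x \<Rightarrow> 'x) \<Rightarrow> 'y set \<Rightarrow> ('a \<Rightarrow> 'y \<Rightarrow> 'y)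
      \<Rightarrow> ('x \<Rightarrow> 'y) \<Rightarrow> bool" where
  "act_iso S A act B act' f \<longleftrightarrow>
     bij_betw f A B \<and> (\<forall>s\<in>carrier S. \<forall>x\<in>A. f (act s x) = act' s (f x))"

text \<open>Free generating sets are taken in \<open>nat\<close>; every finite set is in bijection with such a set.\<close>

definition fp_act ::
    "('a, 'm) monoid_scheme \<Rightarrow> 'x set \<Rightarrow> ('a \<Rightarrow> 'x \<Rightarrow> 'x) \<Rightarrow> bool" where
  "fp_act S A act \<longleftrightarrow> left_act S A act \<and>
     (\<exists>(X :: nat set) \<rho> f. finite X \<and> fg_congruence S (carrier S \<times> X) (free_act S) \<rho> \<and>
        act_iso S A act ((carrier S \<times> X) // \<rho>) (quotient_act \<rho> (free_act S)) f)"

text \<open>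
  The ambient act ranges over acts on the type \<open>('a \<times> nat) set\<close>. This is no restriction, since
  every finitely presented act is isomorphic to one on this type: see \<open>left_coherent_any_type\<close>.
\<close>

definition left_coherent :: "('a, 'm) monoid_scheme \<Rightarrow> bool" where
  "left_coherent S \<longleftrightarrow>
     (\<forall>(A :: ('a \<times> nat) set set) act B.
        fp_act S A act \<longrightarrow> fg_subact S A act B \<longrightarrow> fp_act S B act)"

lemma left_act_free: "monoid S \<Longrightarrow> left_act S (carrier S \<times> X) (free_act S)"
  by (auto simp: left_act_def left_act_axioms_def free_act_def monoid.m_assoc monoid.m_closed)

lemma act_congruence_generated:
  assumes "left_act S A act" "H \<subseteq> A \<times> A"
  shows "act_congruence S A act (generated_congruence S A act H)"
proof -
  interpret left_act S A act by fact
  have top: "act_congruence S A act (A \<times> A)"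
    using act_closed by (auto simp: act_congruence_def equiv_def refl_on_def sym_def trans_def)
  let ?C = "{\<rho>. act_congruence S A act \<rho> \<and> H \<subseteq> \<rho>}"
  have ne: "A \<times> A \<in> ?C" using top assms(2) by auto
  have eq: "\<And>\<rho>. \<rho> \<in> ?C \<Longrightarrow> equiv A \<rho>" by (auto simp: act_congruence_def)
  have "equiv A (\<Inter>?C)"
  proof (rule equivI)
    show "\<Inter>?C \<subseteq> A \<times> A" using ne by blast
    show "refl_on A (\<Inter>?C)"
      using eq by (auto simp: refl_on_def equiv_def)
    show "sym (\<Inter>?C)" using eq by (auto simp: equiv_def intro!: symI dest: symD)
    show "trans (\<Inter>?C)"
    proof (rule transI)
      fix x y z assume "(x, y) \<in> \<Inter>?C" "(y, z) \<in> \<Inter>?C"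
      then show "(x, z) \<in> \<Inter>?C" using eq by (meson InterE InterI equivE transE)
    qed
  qed
  moreover have "(act s x, act s y) \<in> \<Inter>?C"
    if "s \<in> carrier S" "(x, y) \<in> \<Inter>?C" for s x y
  proof (rule InterI)
    fix \<rho> assume r: "\<rho> \<in> ?C"
    then have "(x, y) \<in> \<rho>" using that by blast
    moreover have "\<forall>s\<in>carrier S. \<forall>(x, y)\<in>\<rho>. (act s x, act s y) \<in> \<rho>"
      using r by (simp add: act_congruence_def)
    ultimately show "(act s x, act s y) \<in> \<rho>" using that(1) by blast
  qed
  ultimately show ?thesis by (auto simp: act_congruence_def generated_congruence_def)
qed

lemma quotient_act_class:
  assumes "act_congruence S A act \<rho>" "s \<in> carrier S" "x \<in> A"
  shows "quotient_act \<rho> act s (\<rho> `` {x}) = \<rho> `` {act s x}"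
proof -
  have e: "equiv A \<rho>" using assms(1) by (simp add: act_congruence_def)
  have x: "x \<in> \<rho> `` {x}" using e assms(3) by (rule equiv_class_self)
  have "\<rho> `` {act s y} = \<rho> `` {act s x}" if "y \<in> \<rho> `` {x}" for y
  proof -
    have "(act s x, act s y) \<in> \<rho>" using that assms by (auto simp: act_congruence_def)
    then show ?thesis using equiv_class_eq[OF e] by metis
  qed
  then show ?thesis unfolding quotient_act_def using x by blast
qed

lemma left_act_quotient:
  assumes "left_act S A act" "act_congruence S A act \<rho>"
  shows "left_act S (A // \<rho>) (quotient_act \<rho> act)"
proof -
  interpret left_act S A act by fact
  show ?thesis
    by unfold_locales
      (auto elim!: quotientE simp: quotient_act_class[OF assms(2)] act_closed act_unit act_assoc
        intro!: quotientI)
qed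

lemma subact_image:
  assumes "act_iso S A act A' act' f" "subact S A act B"
  shows "subact S A' act' (f ` B)"
  unfolding subact_def
proof (intro conjI ballI)
  show "f ` B \<subseteq> A'" using assms by (auto simp: act_iso_def subact_def bij_betw_def)
  fix s y assume s: "s \<in> carrier S" and "y \<in> f ` B"
  then obtain x where x: "x \<in> B" "y = f x" by blast
  then have "act' s y = f (act s x)" using assms s by (auto simp: act_iso_def subact_def)
  then show "act' s y \<in> f ` B" using assms(2) s x by (auto simp: subact_def)
qed

lemma act_iso_inv:
  assumes "left_act S A act" "act_iso S A act A' act' f"
  shows "act_iso S A' act' A act (inv_into A f)"
proof -
  interpret left_act S A act by fact
  have b: "bij_betw f A A'" and h: "\<And>s x. \<lbrakk>s \<in> carrier S; x \<in> A\<rbrakk> \<Longrightarrow> f (act s x) = act' s (f x)"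
    using assms(2) by (auto simp: act_iso_def)
  have "inv_into A f (act' s y) = act s (inv_into A f y)" if "s \<in> carrier S" "y \<in> A'" for s y
  proof -
    let ?x = "inv_into A f y"
    have x: "?x \<in> A" "f ?x = y"
      using b that by (auto simp: bij_betw_def inv_into_into f_inv_into_f)
    then have "act' s y = f (act s ?x)" using h that by simp
    moreover have "act s ?x \<in> A" using that(1) x(1) by (rule act_closed)
    ultimately show ?thesis using b by (simp add: bij_betw_inv_into_left)
  qed
  then show ?thesis using b by (simp add: act_iso_def bij_betw_inv_into)
qed

lemma generated_subact_image:
  assumes "left_act S A act" "act_iso S A act A' act' f" "X \<subseteq> A"
  shows "f ` generated_subact S A act X = generated_subact S A' act' (f ` X)"
proof
  have b: "bij_betw f A A'" using assms(2) by (simp add: act_iso_def)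
  let ?g = "inv_into A f"
  have gf: "?g ` f ` C = C" if "C \<subseteq> A" for C
    using b that by (simp add: bij_betw_def inv_into_image_cancel)
  have fg: "f ` ?g ` C = C" if "C \<subseteq> A'" for C
    using b that by (simp add: bij_betw_def image_inv_into_cancel)
  have top: "subact S A act A" using left_act.act_closed[OF assms(1)] by (auto simp: subact_def)
  show "f ` generated_subact S A act X \<subseteq> generated_subact S A' act' (f ` X)"
  proof -
    have "f ` generated_subact S A act X \<subseteq> C" if c: "subact S A' act' C" "f ` X \<subseteq> C" for C
    proof -
      have "subact S A act (?g ` C)" using subact_image[OF act_iso_inv[OF assms(1,2)] c(1)] .
      moreover have "X \<subseteq> ?g ` C" using gf[OF assms(3)] c(2) by blast
      ultimately have "generated_subact S A act X \<subseteq> ?g ` C"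
        by (auto simp: generated_subact_def)
      then show ?thesis using fg[of C] c(1) by (auto simp: subact_def)
    qed
    then show ?thesis unfolding generated_subact_def[of S A'] by blast
  qed
  show "generated_subact S A' act' (f ` X) \<subseteq> f ` generated_subact S A act X"
  proof
    fix y assume y: "y \<in> generated_subact S A' act' (f ` X)"
    have *: "y \<in> f ` C" if "subact S A act C" "X \<subseteq> C" for C
      using y subact_image[OF assms(2) that(1)] that(2) by (auto simp: generated_subact_def)
    then obtain x where x: "x \<in> A" "y = f x" using top assms(3) by blast
    have "x \<in> C" if "subact S A act C" "X \<subseteq> C" for C
    proof -
      obtain c where "c \<in> C" "y = f c" using * \<open>subact S A act C\<close> \<open>X \<subseteq> C\<close> by blast
      moreover have "c \<in> A" using \<open>c \<in> C\<close> that(1) by (auto simp: subact_def)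
      ultimately show ?thesis using x b by (auto simp: bij_betw_def dest: inj_onD)
    qed
    then show "y \<in> f ` generated_subact S A act X" using x(2) by (auto simp: generated_subact_def)
  qed
qed

lemma left_coherent_any_type:
  fixes A :: "'x set" and S :: "('a, 'm) monoid_scheme"
  assumes "left_coherent S" "fp_act S A act" "fg_subact S A act B"
  shows "fp_act S B act"
proof -
  obtain X :: "nat set" and \<rho> f where X: "finite X"
    and \<rho>: "fg_congruence S (carrier S \<times> X) (free_act S) \<rho>"
    and f: "act_iso S A act ((carrier S \<times> X) // \<rho>) (quotient_act \<rho> (free_act S)) f"
    using assms(2) unfolding fp_act_def by blast
  let ?Q = "(carrier S \<times> X) // \<rho>" and ?q = "quotient_act \<rho> (free_act S)"
  have A: "left_act S A act" using assms(2) by (simp add: fp_act_def)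
  then interpret left_act S A act .
  have "act_congruence S (carrier S \<times> X) (free_act S) \<rho>"
    using \<rho> act_congruence_generated[OF left_act_free[OF monoid_axioms]]
    by (auto simp: fg_congruence_def)
  then have "left_act S ?Q ?q" by (rule left_act_quotient[OF left_act_free[OF monoid_axioms]])
  moreover have "act_iso S ?Q ?q ?Q ?q id" by (simp add: act_iso_def)
  ultimately have Q: "fp_act S ?Q ?q" using X \<rho> unfolding fp_act_def by blast
  obtain Z where Z: "finite Z" "Z \<subseteq> A" "B = generated_subact S A act Z"
    using assms(3) by (auto simp: fg_subact_def)
  have "f ` Z \<subseteq> ?Q" using f Z(2) by (auto simp: act_iso_def bij_betw_def)
  then have "fg_subact S ?Q ?q (f ` B)"
    unfolding fg_subact_def Z(3) generated_subact_image[OF A f Z(2)] using Z(1) by blast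
  then have "fp_act S (f ` B) ?q" using assms(1) Q by (auto simp: left_coherent_def)
  then obtain X' :: "nat set" and \<rho>' h where X': "finite X'"
    and \<rho>': "fg_congruence S (carrier S \<times> X') (free_act S) \<rho>'"
    and h: "act_iso S (f ` B) ?q ((carrier S \<times> X') // \<rho>') (quotient_act \<rho>' (free_act S)) h"
    unfolding fp_act_def by blast
  have top: "subact S A act A" using act_closed by (auto simp: subact_def)
  have BA: "B \<subseteq> A" using Z top by (auto simp: generated_subact_def)
  have B: "subact S A act B"
    unfolding subact_def
  proof (intro conjI ballI BA)
    fix s x assume "s \<in> carrier S" "x \<in> B"
    then show "act s x \<in> B" by (auto simp: Z(3) generated_subact_def subact_def)
  qed
  have "left_act S B act"
    using B act_unit act_assoc by unfold_locales (auto simp: subact_def)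
  moreover have "bij_betw (h \<circ> f) B ((carrier S \<times> X') // \<rho>')"
  proof (rule bij_betw_trans)
    show "bij_betw f B (f ` B)" using f BA by (auto simp: act_iso_def bij_betw_def inj_on_subset)
    show "bij_betw h (f ` B) ((carrier S \<times> X') // \<rho>')" using h by (simp add: act_iso_def)
  qed
  then have "act_iso S B act ((carrier S \<times> X') // \<rho>') (quotient_act \<rho>' (free_act S)) (h \<circ> f)"
    using f h BA by (auto simp: act_iso_def)
  ultimately show ?thesis using X' \<rho>' unfolding fp_act_def by blast
qed

end

theory Submission
  imports Defs
begin

text \<open>
  The identities about an \<open>E\<close>-unitary inverse monoid \<open>F\<close> rest on one observation: \<open>c\<close> is
  idempotent as soon as \<open>c \<otimes> e\<close> is idempotent for a single idempotent \<open>e\<close>. If \<open>t \<otimes> x\<close> is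
  idempotent, then so is \<open>x \<otimes> t\<close>, and an idempotent equals its inverse (\<open>idem_product\<close>). If
  \<open>x \<otimes> w = y \<otimes> w\<close>, then \<open>t \<otimes> x\<close> and \<open>t \<otimes> y\<close> agree after multiplication by the idempotent
  \<open>w \<otimes> w\<^sup>-\<close> (\<open>idem_product_transfer\<close>, \<open>star_fixes_transfer\<close>).

  The embedding into a semidirect product uses the maximal group image \<open>G\<close> of \<open>F\<close>, with
  quotient map \<open>\<sigma>\<close>. Being \<open>E\<close>-unitary means that \<open>c\<close> is determined by the point
  \<open>(\<sigma> c, c\<^sup>- c)\<close> of \<open>G \<times> F\<close>. Let \<open>K a\<close> be the set of points of the right ideal
  \<open>a F\<close>. Then \<open>K (a b) = K a \<inter> \<sigma> a \<cdot> K b\<close>, where \<open>G\<close> acts by translation, so that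
  \<open>a \<mapsto> (K a, \<sigma> a)\<close> is an embedding into the semidirect product of the power set of \<open>G \<times> F\<close>
  with \<open>G\<close>.

  For non-coherence, take the quotient of the left act \<open>M\<close> by the congruence generated by
  \<open>(a, u)\<close>, where \<open>u\<close> is the identity of \<open>M\<close>, and in it the subact generated by the class of
  \<open>b\<close>. Elements \<open>x\<close> and \<open>y\<close> act alike on this class iff \<open>x b a\<^sup>m = y b a\<^sup>n\<close> for some \<open>m\<close> and
  \<open>n\<close>. If \<open>M\<close> were left coherent, this left congruence on \<open>M\<close> would be generated by a finite set
  \<open>H\<close> (\<open>fg_annihilator_if_left_coherent\<close>). Let \<open>N\<close> bound the exponents that witness the pairs
  in \<open>H\<close>, and let \<open>T\<close> be the set of idempotents that fix \<open>b a\<^sup>N\<close>. The identities and the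
  incomparability of the elements \<open>b a\<^sup>i\<close> imply that \<open>T\<close> does not separate
  the left translates of a pair \<open>(z, z')\<close> in \<open>H\<close>: \<open>t z \<in> T\<close> iff \<open>t z' \<in> T\<close>
  (\<open>idem_fixing_transfer\<close>). Thus \<open>H\<close> lies in the syntactic congruence of \<open>T\<close>, and so does everything that it generates. But \<open>(u, e\<^sub>N\<^sub>+\<^sub>1)\<close>
  belongs to the congruence, by equality after multiplication by \<open>b a\<^sup>N\<^sup>+\<^sup>1\<close>, while \<open>u\<close> is in \<open>T\<close>
  and \<open>e\<^sub>N\<^sub>+\<^sub>1\<close> is not.
\<close>

section \<open>Inverse monoids\<close>

context inverse_monoid
begin

abbreviation sinv_of :: "'a \<Rightarrow> 'a" ("_\<^sup>-" [1000] 999) where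
  "x\<^sup>- \<equiv> sinv S x"

abbreviation E :: "'a set" where
  "E \<equiv> idempotents S"

lemma sinv_is_sinv: "x \<in> carrier S \<Longrightarrow> is_sinv S x (x\<^sup>-)"
  unfolding sinv_def by (rule theI'[OF ex1_sinv])

lemma sinv_eqI: "\<lbrakk>x \<in> carrier S; is_sinv S x y\<rbrakk> \<Longrightarrow> x\<^sup>- = y"
  using ex1_sinv sinv_is_sinv by blast

lemma sinv_closed [simp]: "x \<in> carrier S \<Longrightarrow> x\<^sup>- \<in> carrier S"
  using sinv_is_sinv by (auto simp: is_sinv_def)

lemma mult_sinv_mult [simp]: "x \<in> carrier S \<Longrightarrow> x \<otimes> (x\<^sup>- \<otimes> x) = x"
  using sinv_is_sinv[of x] by (auto simp: is_sinv_def m_assoc)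

lemma sinv_mult_sinv [simp]: "x \<in> carrier S \<Longrightarrow> x\<^sup>- \<otimes> (x \<otimes> x\<^sup>-) = x\<^sup>-"
  using sinv_is_sinv[of x] by (auto simp: is_sinv_def m_assoc)

lemma mult_sinv_mult_assoc [simp]:
  "\<lbrakk>x \<in> carrier S; z \<in> carrier S\<rbrakk> \<Longrightarrow> x \<otimes> (x\<^sup>- \<otimes> (x \<otimes> z)) = x \<otimes> z"
proof -
  assume x: "x \<in> carrier S" and z: "z \<in> carrier S"
  have "x \<otimes> (x\<^sup>- \<otimes> x) \<otimes> z = x \<otimes> z" using x by simp
  then show ?thesis using x z by (simp add: m_assoc del: mult_sinv_mult)
qed

lemma sinv_mult_sinv_assoc [simp]:
  "\<lbrakk>x \<in> carrier S; z \<in> carrier S\<rbrakk> \<Longrightarrow> x\<^sup>- \<otimes> (x \<otimes> (x\<^sup>- \<otimes> z)) = x\<^sup>- \<otimes> z"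
proof -
  assume x: "x \<in> carrier S" and z: "z \<in> carrier S"
  have "x\<^sup>- \<otimes> (x \<otimes> x\<^sup>-) \<otimes> z = x\<^sup>- \<otimes> z" using x by simp
  then show ?thesis using x z by (simp add: m_assoc del: sinv_mult_sinv)
qed

lemma sinv_sinv [simp]: "x \<in> carrier S \<Longrightarrow> (x\<^sup>-)\<^sup>- = x"
  by (rule sinv_eqI) (auto simp: is_sinv_def m_assoc)

lemma idem_closed [simp]: "e \<in> E \<Longrightarrow> e \<in> carrier S"
  by (simp add: idempotents_def)

lemma idem_mult [simp]: "e \<in> E \<Longrightarrow> e \<otimes> e = e"
  unfolding idempotents_def by blast

lemma idem_mult_assoc [simp]: "\<lbrakk>e \<in> E; z \<in> carrier S\<rbrakk> \<Longrightarrow> e \<otimes> (e \<otimes> z) = e \<otimes> z"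
  by (simp flip: m_assoc)

lemma idemI: "\<lbrakk>e \<in> carrier S; e \<otimes> e = e\<rbrakk> \<Longrightarrow> e \<in> E"
  unfolding idempotents_def by blast

lemma sinv_idem: "e \<in> E \<Longrightarrow> e\<^sup>- = e"
  by (rule sinv_eqI) (auto simp: is_sinv_def)

text \<open>If \<open>x\<close> is the inverse of \<open>e \<otimes> f\<close>, then so is \<open>f \<otimes> x \<otimes> e\<close>, which is idempotent.
  Hence \<open>x\<close> is idempotent, and it coincides with its own inverse \<open>e \<otimes> f\<close>.\<close>

lemma idem_mult_closed [simp]:
  assumes e: "e \<in> E" and f: "f \<in> E"
  shows "e \<otimes> f \<in> E"
proof -
  define x where "x = (e \<otimes> f)\<^sup>-"
  have x: "x \<in> carrier S" using e f by (simp add: x_def)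
  have efx: "e \<otimes> (f \<otimes> (x \<otimes> (e \<otimes> f))) = e \<otimes> f"
    using e f x mult_sinv_mult[of "e \<otimes> f", folded x_def] by (simp add: m_assoc)
  have xef: "x \<otimes> (e \<otimes> (f \<otimes> x)) = x"
    using e f x sinv_mult_sinv[of "e \<otimes> f", folded x_def] by (simp add: m_assoc)
  have xef': "x \<otimes> (e \<otimes> (f \<otimes> (x \<otimes> z))) = x \<otimes> z" if "z \<in> carrier S" for z
    using that e f x xef by (metis m_assoc m_closed idem_closed)
  have "is_sinv S (e \<otimes> f) (f \<otimes> x \<otimes> e)"
    using e f x efx xef' by (simp add: is_sinv_def m_assoc)
  then have "x = f \<otimes> x \<otimes> e" using e f unfolding x_def by (intro sinv_eqI) simp_all
  also have "\<dots> = f \<otimes> (x \<otimes> e)" using e f x by (simp add: m_assoc)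
  finally have eq: "x = f \<otimes> (x \<otimes> e)" .
  have "x \<otimes> x = f \<otimes> (x \<otimes> e) \<otimes> (f \<otimes> (x \<otimes> e))"
    by (rule arg_cong2[OF eq eq])
  also have "\<dots> = f \<otimes> (x \<otimes> e)" using e f x xef' by (simp add: m_assoc)
  also have "\<dots> = x" by (rule eq[symmetric])
  finally have "x \<in> E" using x by (rule idemI[rotated])
  then have "x = e \<otimes> f" using sinv_idem[of x] e f by (simp add: x_def)
  with \<open>x \<in> E\<close> show ?thesis by simp
qed

text \<open>Both \<open>e \<otimes> f\<close> and \<open>f \<otimes> e\<close> are inverse to the idempotent \<open>e \<otimes> f\<close>.\<close>

lemma idem_comm:
  assumes e: "e \<in> E" and f: "f \<in> E"
  shows "e \<otimes> f = f \<otimes> e"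
proof -
  have 1: "e \<otimes> (f \<otimes> (e \<otimes> f)) = e \<otimes> f" "f \<otimes> (e \<otimes> (f \<otimes> e)) = f \<otimes> e"
    using idem_mult[OF idem_mult_closed[OF e f]] idem_mult[OF idem_mult_closed[OF f e]] e f
    by (simp_all add: m_assoc del: idem_mult)
  have "is_sinv S (e \<otimes> f) (f \<otimes> e)"
    using e f 1 by (simp add: is_sinv_def m_assoc)
  then have "(e \<otimes> f)\<^sup>- = f \<otimes> e" using e f by (simp add: sinv_eqI)
  then show ?thesis using e f by (simp add: sinv_idem)
qed

lemma idem_left_comm:
  "\<lbrakk>e \<in> E; f \<in> E; z \<in> carrier S\<rbrakk> \<Longrightarrow> e \<otimes> (f \<otimes> z) = f \<otimes> (e \<otimes> z)"
  by (metis idem_comm idem_closed m_assoc)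

lemma mult_sinv_idem [simp]: "x \<in> carrier S \<Longrightarrow> x \<otimes> x\<^sup>- \<in> E"
  by (rule idemI) (auto simp: m_assoc)

lemma sinv_mult_idem [simp]: "x \<in> carrier S \<Longrightarrow> x\<^sup>- \<otimes> x \<in> E"
  by (rule idemI) (auto simp: m_assoc)

text \<open>The idempotents \<open>x\<^sup>- \<otimes> x\<close> and \<open>y \<otimes> y\<^sup>-\<close>, adjacent in \<open>x \<otimes> y \<otimes> (y\<^sup>- \<otimes> x\<^sup>-) \<otimes> (x \<otimes> y)\<close>,
  commute.\<close>

lemma sinv_mult:
  assumes x: "x \<in> carrier S" and y: "y \<in> carrier S"
  shows "(x \<otimes> y)\<^sup>- = y\<^sup>- \<otimes> x\<^sup>-"
proof -
  have c: "x\<^sup>- \<otimes> (x \<otimes> (y \<otimes> (y\<^sup>- \<otimes> z))) = y \<otimes> (y\<^sup>- \<otimes> (x\<^sup>- \<otimes> (x \<otimes> z)))"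
    if "z \<in> carrier S" for z
    using idem_left_comm[OF sinv_mult_idem[OF x] mult_sinv_idem[OF y] that] x y that by (simp add: m_assoc)
  have "x \<otimes> (y \<otimes> (y\<^sup>- \<otimes> (x\<^sup>- \<otimes> (x \<otimes> y)))) = x \<otimes> y"
    using c[of y] x y by (simp flip: c)
  moreover have "y\<^sup>- \<otimes> (x\<^sup>- \<otimes> (x \<otimes> (y \<otimes> (y\<^sup>- \<otimes> x\<^sup>-)))) = y\<^sup>- \<otimes> x\<^sup>-"
    using x y by (simp add: c)
  ultimately show ?thesis
    using x y by (intro sinv_eqI) (simp_all add: is_sinv_def m_assoc)
qed

lemma conj_idem [simp]:
  assumes x: "x \<in> carrier S" and e: "e \<in> E"
  shows "x \<otimes> (e \<otimes> x\<^sup>-) \<in> E"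
proof (rule idemI)
  have "x\<^sup>- \<otimes> (x \<otimes> (e \<otimes> x\<^sup>-)) = e \<otimes> x\<^sup>-"
    using idem_left_comm[OF sinv_mult_idem[OF x] e, of "x\<^sup>-"] x e by (simp add: m_assoc)
  then show "x \<otimes> (e \<otimes> x\<^sup>-) \<otimes> (x \<otimes> (e \<otimes> x\<^sup>-)) = x \<otimes> (e \<otimes> x\<^sup>-)"
    using x e by (simp add: m_assoc)
qed (use x e in simp)

lemma conj_idem' [simp]: "\<lbrakk>x \<in> carrier S; e \<in> E\<rbrakk> \<Longrightarrow> x\<^sup>- \<otimes> (e \<otimes> x) \<in> E"
  using conj_idem[of "x\<^sup>-" e] by simp

text \<open>An idempotent passes from one side of \<open>x\<close> to the other as a conjugate.\<close>

lemma idem_past: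
  assumes x: "x \<in> carrier S" and e: "e \<in> E"
  shows "x \<otimes> (x\<^sup>- \<otimes> (e \<otimes> x)) = e \<otimes> x"
  using idem_left_comm[OF mult_sinv_idem[OF x] e x] x e by (simp add: m_assoc)

lemma idem_past':
  assumes x: "x \<in> carrier S" and e: "e \<in> E"
  shows "x \<otimes> (e \<otimes> (x\<^sup>- \<otimes> x)) = x \<otimes> e"
  using idem_comm[OF sinv_mult_idem[OF x] e] x e by (simp flip: idem_comm[OF sinv_mult_idem[OF x] e] add: m_assoc)

end


section \<open>Consequences of being \<open>E\<close>-unitary\<close>

context E_unitary_inverse_monoid
begin

text \<open>An idempotent factor anywhere inside a product can be moved to its right end, so that
  it can be cancelled in memberships in \<open>E\<close>.\<close>

lemma E_unitary_middle:
  assumes "a \<in> carrier S" "b \<in> carrier S" "e \<in> E" "a \<otimes> (e \<otimes> b) \<in> E"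
  shows "a \<otimes> b \<in> E"
  using assms E_unitary[of "a \<otimes> b" "b\<^sup>- \<otimes> (e \<otimes> b)"] by (simp add: m_assoc idem_past)

text \<open>As \<open>x \<otimes> t\<close> is again idempotent, it equals its inverse \<open>t\<^sup>- \<otimes> x\<^sup>-\<close>.\<close>

lemma idem_product:
  assumes t: "t \<in> carrier S" and x: "x \<in> carrier S" and e: "t \<otimes> x \<in> E"
  shows "t \<otimes> x = plus_idem S t \<otimes> star_idem S x"
proof -
  have "x \<otimes> (t \<otimes> x \<otimes> x\<^sup>-) \<in> E" using conj_idem[OF x e] .
  then have "x \<otimes> t \<in> E" using t x E_unitary[of "x \<otimes> t" "x \<otimes> x\<^sup>-"] by (simp add: m_assoc)
  then have xt: "x \<otimes> t = t\<^sup>- \<otimes> x\<^sup>-" using t x sinv_idem sinv_mult by metis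
  have "plus_idem S t \<otimes> star_idem S x = t \<otimes> (t\<^sup>- \<otimes> x\<^sup>- \<otimes> x)"
    using t x by (simp add: plus_idem_def star_idem_def m_assoc)
  also have "\<dots> = t \<otimes> x \<otimes> (t \<otimes> x)" using t x by (simp flip: xt add: m_assoc)
  finally show ?thesis using e by simp
qed

lemma idem_product_transfer:
  assumes "t \<in> carrier S" "x \<in> carrier S" "y \<in> carrier S" "w \<in> carrier S"
    and e: "t \<otimes> x \<in> E" and eq: "x \<otimes> w = y \<otimes> w"
  shows "t \<otimes> y \<in> E"
proof -
  have "t \<otimes> x \<otimes> (w \<otimes> w\<^sup>-) \<in> E" using assms by simp
  also have "t \<otimes> x \<otimes> (w \<otimes> w\<^sup>-) = t \<otimes> (x \<otimes> w) \<otimes> w\<^sup>-" using assms(1-4) by (simp add: m_assoc)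
  also have "\<dots> = t \<otimes> y \<otimes> (w \<otimes> w\<^sup>-)" unfolding eq using assms(1-4) by (simp add: m_assoc)
  finally show ?thesis
    using assms(1-4) by (intro E_unitary[of "t \<otimes> y" "w \<otimes> w\<^sup>-"]) simp_all
qed

text \<open>Here \<open>x\<^sup>- \<otimes> y\<close> fixes \<open>c\<close>, which makes it idempotent and hence equal to \<open>y\<^sup>- \<otimes> x\<close>.\<close>

lemma star_fixes_transfer:
  assumes x: "x \<in> carrier S" and y: "y \<in> carrier S" and c: "c \<in> carrier S"
    and eq: "x \<otimes> c = y \<otimes> c" and fix_x: "star_idem S x \<otimes> c = c"
  shows "star_idem S y \<otimes> c = c"
proof -
  have xyc: "x\<^sup>- \<otimes> y \<otimes> c = c"
    using x y c fix_x by (simp flip: eq add: star_idem_def m_assoc)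
  then have "x\<^sup>- \<otimes> y \<otimes> (c \<otimes> c\<^sup>-) = c \<otimes> c\<^sup>-"
    using x y c by (metis m_assoc m_closed sinv_closed)
  then have "x\<^sup>- \<otimes> y \<in> E"
    using x y c E_unitary[of "x\<^sup>- \<otimes> y" "c \<otimes> c\<^sup>-"] by simp
  then have "x\<^sup>- \<otimes> y = y\<^sup>- \<otimes> x" using x y sinv_idem sinv_mult sinv_sinv sinv_closed by metis
  then have "y\<^sup>- \<otimes> (x \<otimes> c) = c" using xyc x y c by (simp add: m_assoc)
  then show ?thesis using x y c by (simp add: eq star_idem_def m_assoc)
qed

end


section \<open>The embedding into a semidirect product\<close>

context inverse_monoid
begin

text \<open>This is the least congruence whose quotient is a group.\<close>

definition sigma_rel :: "'a \<Rightarrow> 'a \<Rightarrow> bool" where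
  "sigma_rel x y \<longleftrightarrow> (\<exists>e\<in>E. e \<otimes> x = e \<otimes> y)"

definition sigma :: "'a \<Rightarrow> 'a set" where
  "sigma x = {y \<in> carrier S. sigma_rel x y}"

definition sigma_group :: "'a set monoid" where
  "sigma_group = \<lparr>carrier = sigma ` carrier S,
     mult = (\<lambda>A B. \<Union>a\<in>A. \<Union>b\<in>B. sigma (a \<otimes> b)), one = sigma \<one>\<rparr>"

lemma sigma_rel_sym: "sigma_rel x y \<Longrightarrow> sigma_rel y x"
  unfolding sigma_rel_def by metis

lemma one_idem [simp]: "\<one> \<in> E"
  by (rule idemI) auto

lemma sigma_rel_refl [simp]: "sigma_rel x x"
  unfolding sigma_rel_def using one_idem by blast

text \<open>The product of two witnessing idempotents is a witness, as idempotents commute.\<close>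

lemma sigma_rel_trans:
  assumes "x \<in> carrier S" "y \<in> carrier S" "z \<in> carrier S" "sigma_rel x y" "sigma_rel y z"
  shows "sigma_rel x z"
proof -
  obtain e f where e: "e \<in> E" "e \<otimes> x = e \<otimes> y" and f: "f \<in> E" "f \<otimes> y = f \<otimes> z"
    using assms(4,5) by (auto simp: sigma_rel_def)
  have "f \<otimes> e \<otimes> x = f \<otimes> (e \<otimes> y)" using assms e f by (simp add: m_assoc)
  also have "\<dots> = e \<otimes> (f \<otimes> y)" using assms e f by (simp add: idem_left_comm)
  also have "\<dots> = f \<otimes> e \<otimes> z" using assms e f by (simp add: m_assoc idem_left_comm)
  finally show ?thesis using e f unfolding sigma_rel_def by (meson idem_mult_closed)
qed

lemma sigma_eq_iff:
  assumes "x \<in> carrier S" "y \<in> carrier S"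
  shows "sigma x = sigma y \<longleftrightarrow> sigma_rel x y"
proof
  assume "sigma x = sigma y"
  moreover have "y \<in> sigma y" using assms sigma_rel_refl unfolding sigma_def by blast
  ultimately have "y \<in> sigma x" by simp
  then show "sigma_rel x y" unfolding sigma_def by blast
next
  assume xy: "sigma_rel x y"
  have "sigma_rel x z \<longleftrightarrow> sigma_rel y z" if "z \<in> carrier S" for z
    using sigma_rel_trans[OF assms that xy] sigma_rel_trans[OF assms(2,1) that sigma_rel_sym[OF xy]]
    by blast
  then show "sigma x = sigma y" unfolding sigma_def by blast
qed

text \<open>For left multiplication by \<open>a\<close> the witness \<open>f\<close> is replaced by its conjugate
  \<open>a \<otimes> f \<otimes> a\<^sup>-\<close>.\<close>

lemma sigma_rel_mult:
  assumes "a \<in> carrier S" "b \<in> carrier S" "a' \<in> carrier S" "b' \<in> carrier S"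
    and "sigma_rel a a'" "sigma_rel b b'"
  shows "sigma_rel (a \<otimes> b) (a' \<otimes> b')"
proof -
  obtain e f where e: "e \<in> E" "e \<otimes> a = e \<otimes> a'" and f: "f \<in> E" "f \<otimes> b = f \<otimes> b'"
    using assms(5,6) by (auto simp: sigma_rel_def)
  have past: "a \<otimes> (f \<otimes> (a\<^sup>- \<otimes> (a \<otimes> z))) = a \<otimes> (f \<otimes> z)" if "z \<in> carrier S" for z
    using arg_cong[OF idem_past'[OF assms(1) f(1)], of "\<lambda>s. s \<otimes> z"] that assms f
    by (simp add: m_assoc)
  have "a \<otimes> (f \<otimes> a\<^sup>-) \<otimes> (a \<otimes> b) = a \<otimes> (f \<otimes> a\<^sup>-) \<otimes> (a \<otimes> b')"
    using assms f by (simp add: m_assoc past)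
  then have 1: "sigma_rel (a \<otimes> b) (a \<otimes> b')"
    unfolding sigma_rel_def using assms f conj_idem by blast
  have "e \<otimes> (a \<otimes> b') = e \<otimes> (a' \<otimes> b')" using assms e by (metis idem_closed m_assoc)
  then have "sigma_rel (a \<otimes> b') (a' \<otimes> b')" unfolding sigma_rel_def using e by blast
  then show ?thesis using 1 sigma_rel_trans assms by (meson m_closed)
qed

lemma sigma_mult:
  assumes "a \<in> carrier S" "b \<in> carrier S"
  shows "sigma a \<otimes>\<^bsub>sigma_group\<^esub> sigma b = sigma (a \<otimes> b)"
proof -
  have "sigma (a' \<otimes> b') = sigma (a \<otimes> b)" if "a' \<in> sigma a" "b' \<in> sigma b" for a' b'
  proof -
    have "a' \<in> carrier S" "b' \<in> carrier S" "sigma_rel a a'" "sigma_rel b b'"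
      using that unfolding sigma_def by blast+
    then show ?thesis
      using assms sigma_rel_mult[of a b a' b'] sigma_eq_iff[of "a \<otimes> b" "a' \<otimes> b'"] m_closed
      by metis
  qed
  moreover have "a \<in> sigma a" "b \<in> sigma b"
    using assms sigma_rel_refl unfolding sigma_def by blast+
  ultimately have "(\<Union>a'\<in>sigma a. \<Union>b'\<in>sigma b. sigma (a' \<otimes> b')) = sigma (a \<otimes> b)"
    by blast
  then show ?thesis by (simp add: sigma_group_def)
qed

lemma sigma_closed [simp]: "x \<in> carrier S \<Longrightarrow> sigma x \<in> carrier sigma_group"
  by (simp add: sigma_group_def)

lemma sigma_one: "\<one>\<^bsub>sigma_group\<^esub> = sigma \<one>"
  by (simp add: sigma_group_def)

lemma sigma_idem: "e \<in> E \<Longrightarrow> sigma e = \<one>\<^bsub>sigma_group\<^esub>"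
  using sigma_eq_iff[of e \<one>] by (auto simp: sigma_one sigma_rel_def intro!: bexI[of _ e])

lemma sigma_groupE:
  assumes "A \<in> carrier sigma_group"
  obtains a where "a \<in> carrier S" "A = sigma a"
  using assms by (auto simp: sigma_group_def)

lemma group_sigma_group: "group sigma_group"
proof (rule groupI)
  fix A assume "A \<in> carrier sigma_group"
  then obtain a where a: "a \<in> carrier S" "A = sigma a" by (rule sigma_groupE)
  have "sigma (a\<^sup>-) \<otimes>\<^bsub>sigma_group\<^esub> A = \<one>\<^bsub>sigma_group\<^esub>"
    using a by (simp add: sigma_mult sigma_idem)
  then show "\<exists>B\<in>carrier sigma_group. B \<otimes>\<^bsub>sigma_group\<^esub> A = \<one>\<^bsub>sigma_group\<^esub>"
    using a sigma_closed[of "a\<^sup>-"] by (intro bexI[of _ "sigma (a\<^sup>-)"]) simp_all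
  show "\<one>\<^bsub>sigma_group\<^esub> \<otimes>\<^bsub>sigma_group\<^esub> A = A"
    using a by (simp add: sigma_one sigma_mult)
qed (auto simp: sigma_one sigma_mult m_assoc elim!: sigma_groupE)

end

text \<open>The power set of \<open>G \<times> X\<close> is a semilattice under intersection, on which \<open>G\<close> acts by
  translation of the first coordinate.\<close>

definition power_semilattice :: "'x set \<Rightarrow> 'x set monoid" where
  "power_semilattice X = \<lparr>carrier = Pow X, mult = (\<inter>), one = X\<rparr>"

definition translation :: "('g, 'n) monoid_scheme \<Rightarrow> 'g \<Rightarrow> ('g \<times> 'x) set \<Rightarrow> ('g \<times> 'x) set" where
  "translation G g A = (\<lambda>(h, x). (g \<otimes>\<^bsub>G\<^esub> h, x)) ` A"

lemma semilattice_action_translation: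
  fixes X :: "'x set"
  assumes "group G"
  shows "semilattice_action (power_semilattice (carrier G \<times> X)) G (translation G)"
proof -
  interpret G: group G by fact
  let ?Y = "power_semilattice (carrier G \<times> X)"
  have Y: "comm_monoid ?Y"
    by (rule comm_monoidI) (auto simp: power_semilattice_def)
  have sub: "translation G g A \<subseteq> carrier G \<times> X" if "g \<in> carrier G" "A \<subseteq> carrier G \<times> X" for g A
    using that by (auto simp: translation_def)
  have int: "translation G g (A \<inter> B) = translation G g A \<inter> translation G g B"
    if "g \<in> carrier G" "A \<subseteq> carrier G \<times> X" "B \<subseteq> carrier G \<times> X" for g A B
  proof -
    have "inj_on (\<lambda>(h, x). (g \<otimes>\<^bsub>G\<^esub> h, x)) (carrier G \<times> X)"
      using that(1) by (auto simp: inj_on_def)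
    then show ?thesis unfolding translation_def using that(2,3) by (rule inj_on_image_Int)
  qed
  have mult: "translation G (g \<otimes>\<^bsub>G\<^esub> h) A = translation G g (translation G h A)"
    if "g \<in> carrier G" "h \<in> carrier G" "A \<subseteq> carrier G \<times> X" for g h A
    unfolding translation_def image_image using that
    by (intro image_cong) (auto simp: G.m_assoc)
  have one: "translation G \<one>\<^bsub>G\<^esub> A = A" if "A \<subseteq> carrier G \<times> X" for A
  proof -
    have "translation G \<one>\<^bsub>G\<^esub> A = id ` A"
      unfolding translation_def using that by (intro image_cong) auto
    then show ?thesis by simp
  qed
  have top: "translation G g (carrier G \<times> X) = carrier G \<times> X" if g: "g \<in> carrier G" for g
  proof
    have "carrier G \<times> X = translation G g (translation G (inv\<^bsub>G\<^esub> g) (carrier G \<times> X))"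
      using g by (simp flip: mult add: one)
    also have "\<dots> \<subseteq> translation G g (carrier G \<times> X)"
      using sub[of "inv\<^bsub>G\<^esub> g" "carrier G \<times> X"] g unfolding translation_def[of G g]
      by (intro image_mono) auto
    finally show "carrier G \<times> X \<subseteq> translation G g (carrier G \<times> X)" .
  qed (use sub g in blast)
  show ?thesis
    unfolding semilattice_action_def semilattice_action_axioms_def
    using Y assms sub int mult one top
    by (auto simp: power_semilattice_def hom_def)
qed

context E_unitary_inverse_monoid
begin

text \<open>For a witness \<open>e\<close> of \<open>sigma_rel a b\<close>, the elements \<open>e \<otimes> a \<otimes> b\<^sup>- = e \<otimes> b \<otimes> b\<^sup>-\<close> and
  \<open>a\<^sup>- \<otimes> e \<otimes> b = a\<^sup>- \<otimes> e \<otimes> a\<close> are idempotent, and \<open>e\<close> can be cancelled.\<close>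

lemma sigma_rel_compatible:
  assumes a: "a \<in> carrier S" and b: "b \<in> carrier S" and "sigma_rel a b"
  shows "a \<otimes> b\<^sup>- \<in> E" "a\<^sup>- \<otimes> b \<in> E"
proof -
  obtain e where e: "e \<in> E" "e \<otimes> a = e \<otimes> b" using assms(3) by (auto simp: sigma_rel_def)
  have "\<one> \<otimes> (e \<otimes> (a \<otimes> b\<^sup>-)) = e \<otimes> a \<otimes> b\<^sup>-" using a b e(1) by (simp add: m_assoc)
  also have "\<dots> = e \<otimes> (b \<otimes> b\<^sup>-)" unfolding e(2) using b e(1) by (simp add: m_assoc)
  finally have "\<one> \<otimes> (a \<otimes> b\<^sup>-) \<in> E"
    using a b e(1) by (intro E_unitary_middle[of \<one> "a \<otimes> b\<^sup>-" e]) simp_all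
  then show "a \<otimes> b\<^sup>- \<in> E" using a b by simp
  have "a\<^sup>- \<otimes> (e \<otimes> b) \<in> E" using a e(1) by (simp flip: e(2))
  then show "a\<^sup>- \<otimes> b \<in> E" using a b e(1) E_unitary_middle[of "a\<^sup>-" b e] by simp
qed

text \<open>The idempotent \<open>f = a \<otimes> b\<^sup>- = b \<otimes> a\<^sup>-\<close> satisfies \<open>a = f \<otimes> b\<close> and \<open>b = f \<otimes> a\<close>.\<close>

lemma sigma_rel_star_eq:
  assumes a: "a \<in> carrier S" and b: "b \<in> carrier S" and r: "sigma_rel a b"
    and eq: "a\<^sup>- \<otimes> a = b\<^sup>- \<otimes> b"
  shows "a = b"
proof -
  let ?f = "a \<otimes> b\<^sup>-"
  have f: "?f \<in> E" using sigma_rel_compatible[OF a b r] by simp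
  have "?f = (a \<otimes> b\<^sup>-)\<^sup>-" using sinv_idem[OF f] by simp
  then have f': "?f = b \<otimes> a\<^sup>-" using a b by (simp add: sinv_mult)
  have "a = a \<otimes> (b\<^sup>- \<otimes> b)" using a by (simp flip: eq)
  then have 1: "a = ?f \<otimes> b" using a b by (simp add: m_assoc)
  have "b = b \<otimes> (a\<^sup>- \<otimes> a)" using b by (simp add: eq)
  then have 2: "b = ?f \<otimes> a" unfolding f' using a b by (simp add: m_assoc)
  have "?f \<otimes> a = ?f \<otimes> (?f \<otimes> b)" using 1 by simp
  also have "\<dots> = ?f \<otimes> b" by (rule idem_mult_assoc[OF f b])
  finally show ?thesis using 1 2 by simp
qed

lemma sigma_rel_plus_eq:
  assumes a: "a \<in> carrier S" and b: "b \<in> carrier S" and r: "sigma_rel a b"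
    and eq: "a \<otimes> a\<^sup>- = b \<otimes> b\<^sup>-"
  shows "a = b"
proof -
  have "sigma (a\<^sup>-) = sigma (b\<^sup>-)"
  proof -
    interpret G: group sigma_group by (rule group_sigma_group)
    have "sigma (a\<^sup>-) \<otimes>\<^bsub>sigma_group\<^esub> sigma a = \<one>\<^bsub>sigma_group\<^esub>"
      "sigma (b\<^sup>-) \<otimes>\<^bsub>sigma_group\<^esub> sigma b = \<one>\<^bsub>sigma_group\<^esub>"
      using a b by (simp_all add: sigma_mult sigma_idem)
    moreover have "sigma a = sigma b" using a b r sigma_eq_iff by simp
    ultimately show ?thesis using a b G.inv_equality by (metis sigma_closed sinv_closed)
  qed
  then have "a\<^sup>- = b\<^sup>-" using a b eq sigma_eq_iff by (intro sigma_rel_star_eq[of "a\<^sup>-" "b\<^sup>-"]) simp_all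
  then show ?thesis using a b by (metis sinv_sinv)
qed

text \<open>Recording \<open>c\<^sup>- \<otimes> c\<close> rather than \<open>c \<otimes> c\<^sup>-\<close> makes left multiplication act on points by
  translation of the group component, up to restriction of the idempotent.\<close>

definition point :: "'a \<Rightarrow> 'a set \<times> 'a" where
  "point c = (sigma c, c\<^sup>- \<otimes> c)"

text \<open>The points of the right ideal generated by \<open>a\<close>.\<close>

definition ideal_points :: "'a \<Rightarrow> ('a set \<times> 'a) set" where
  "ideal_points a = (\<lambda>d. point (a \<otimes> d)) ` carrier S"

lemma point_inj: "\<lbrakk>a \<in> carrier S; b \<in> carrier S; point a = point b\<rbrakk> \<Longrightarrow> a = b"
  using sigma_rel_star_eq sigma_eq_iff by (auto simp: point_def)

text \<open>A point of \<open>a \<otimes> b \<otimes> d\<close> is the translate of the point of \<open>b \<otimes> d \<otimes> e\<close>, where \<open>e\<close> is its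
  idempotent component. Conversely, if the point of \<open>a \<otimes> d\<close> is the translate of the point of an
  element \<open>c\<close> of the right ideal of \<open>b\<close>, then \<open>d \<otimes> e\<close> and \<open>c\<close> have the same point and hence are
  equal, so that \<open>a \<otimes> d = a \<otimes> d \<otimes> e = a \<otimes> c\<close>.\<close>

lemma ideal_points_mult:
  assumes a: "a \<in> carrier S" and b: "b \<in> carrier S"
  shows "ideal_points (a \<otimes> b)
    = ideal_points a \<inter> translation sigma_group (sigma a) (ideal_points b)"
proof (intro equalityI subsetI IntI)
  fix p assume "p \<in> ideal_points (a \<otimes> b)"
  then obtain d where d: "d \<in> carrier S" and p: "p = point (a \<otimes> b \<otimes> d)"
    by (auto simp: ideal_points_def)
  then show "p \<in> ideal_points a"
    using a b by (auto simp: ideal_points_def m_assoc intro!: image_eqI[of _ _ "b \<otimes> d"])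
  let ?c = "b \<otimes> d" and ?e = "(a \<otimes> (b \<otimes> d))\<^sup>- \<otimes> (a \<otimes> (b \<otimes> d))"
  have c: "?c \<in> carrier S" and ac: "a \<otimes> ?c \<in> carrier S" using a b d by auto
  have e: "?e \<in> E" using sinv_mult_idem[OF ac] .
  have e': "?e = ?c\<^sup>- \<otimes> (a\<^sup>- \<otimes> a \<otimes> ?c)" using a c by (simp add: sinv_mult m_assoc)
  have "?c\<^sup>- \<otimes> ?c \<otimes> ?e = ?e" unfolding e' using a c by (simp add: m_assoc)
  then have "(?c \<otimes> ?e)\<^sup>- \<otimes> (?c \<otimes> ?e) = ?e"
    using c e by (simp add: sinv_mult sinv_idem m_assoc)
  moreover have "sigma (?c \<otimes> ?e) = sigma ?c"
  proof -
    interpret G: group sigma_group by (rule group_sigma_group)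
    show ?thesis using c e by (metis G.r_one idem_closed sigma_closed sigma_idem sigma_mult)
  qed
  ultimately have "point (?c \<otimes> ?e) = (sigma ?c, ?e)" by (simp add: point_def)
  moreover have "p = (sigma a \<otimes>\<^bsub>sigma_group\<^esub> sigma ?c, ?e)"
    using p a b d by (simp add: point_def sigma_mult m_assoc)
  moreover have "point (?c \<otimes> ?e) \<in> ideal_points b"
    using b d e by (auto simp: ideal_points_def m_assoc intro!: image_eqI[of _ _ "d \<otimes> ?e"])
  ultimately show "p \<in> translation sigma_group (sigma a) (ideal_points b)"
    by (force simp: translation_def)
next
  fix p assume "p \<in> ideal_points a \<inter> translation sigma_group (sigma a) (ideal_points b)"
  then obtain d d' where d: "d \<in> carrier S" and d': "d' \<in> carrier S" and p: "p = point (a \<otimes> d)"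
    and p': "p = (sigma a \<otimes>\<^bsub>sigma_group\<^esub> sigma (b \<otimes> d'), (b \<otimes> d')\<^sup>- \<otimes> (b \<otimes> d'))"
    by (auto simp: ideal_points_def translation_def point_def)
  let ?c = "b \<otimes> d'" and ?e = "(a \<otimes> d)\<^sup>- \<otimes> (a \<otimes> d)"
  have c: "?c \<in> carrier S" using b d' by simp
  have ce: "?c\<^sup>- \<otimes> ?c = ?e" using p p' by (simp add: point_def)
  have e: "?e \<in> E" using a d by simp
  have "sigma a \<otimes>\<^bsub>sigma_group\<^esub> sigma d = sigma a \<otimes>\<^bsub>sigma_group\<^esub> sigma ?c"
    using p p' a d by (simp add: point_def sigma_mult)
  then have sd: "sigma d = sigma ?c"
    using a c d monoid.Units_l_cancel[OF group.is_monoid[OF group_sigma_group]]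
      group.Units_eq[OF group_sigma_group]
    by (metis sigma_closed)
  have e': "?e = d\<^sup>- \<otimes> (a\<^sup>- \<otimes> a \<otimes> d)" using a d by (simp add: sinv_mult m_assoc)
  have "d\<^sup>- \<otimes> d \<otimes> ?e = ?e" unfolding e' using a d by (simp add: m_assoc)
  then have "(d \<otimes> ?e)\<^sup>- \<otimes> (d \<otimes> ?e) = ?e"
    using d e by (simp add: sinv_mult sinv_idem m_assoc)
  moreover have "sigma (d \<otimes> ?e) = sigma d"
  proof -
    interpret G: group sigma_group by (rule group_sigma_group)
    show ?thesis using d e by (metis G.r_one idem_closed sigma_closed sigma_idem sigma_mult)
  qed
  ultimately have "point (d \<otimes> ?e) = point ?c" using sd ce by (simp add: point_def)
  then have "d \<otimes> ?e = ?c" using point_inj c d e by (meson idem_closed m_closed)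
  moreover have "a \<otimes> d = a \<otimes> (d \<otimes> ?e)"
    using mult_sinv_mult[of "a \<otimes> d"] m_assoc[OF a d idem_closed[OF e]] a d by simp
  ultimately have "a \<otimes> d = a \<otimes> b \<otimes> d'" using a b d' by (simp add: m_assoc)
  then show "p \<in> ideal_points (a \<otimes> b)" using p d' by (auto simp: ideal_points_def)
qed

text \<open>Since points determine elements, the inclusion yields \<open>a = b \<otimes> d\<close> for some \<open>d\<close>.\<close>

lemma ideal_points_plus:
  assumes a: "a \<in> carrier S" and b: "b \<in> carrier S" and sub: "ideal_points a \<subseteq> ideal_points b"
  shows "b \<otimes> b\<^sup>- \<otimes> (a \<otimes> a\<^sup>-) = a \<otimes> a\<^sup>-"
proof -
  have "point (a \<otimes> \<one>) \<in> ideal_points b" using sub unfolding ideal_points_def by blast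
  then obtain d where "d \<in> carrier S" "a = b \<otimes> d"
    using a b point_inj[of a "b \<otimes> _"] by (auto simp: ideal_points_def)
  then show ?thesis using b by (simp add: sinv_mult m_assoc)
qed

definition semidirect_embedding :: "'a \<Rightarrow> ('a set \<times> 'a) set \<times> 'a set" where
  "semidirect_embedding a = (ideal_points a, sigma a)"

abbreviation "point_semilattice \<equiv> power_semilattice (carrier sigma_group \<times> carrier S)"

text \<open>The map need not preserve the identity: the points of \<open>\<one>\<close> can form a proper subset of
  \<open>G \<times> S\<close>. It preserves products, which is what monoid subsemigroups call for.\<close>

lemma semidirect_embedding_hom:
  "semidirect_embedding
    \<in> hom S (semidirect point_semilattice sigma_group (translation sigma_group))"
proof (rule homI)
  fix a assume a: "a \<in> carrier S"
  then show "semidirect_embedding a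
      \<in> carrier (semidirect point_semilattice sigma_group (translation sigma_group))"
    by (auto simp: semidirect_def semidirect_embedding_def power_semilattice_def ideal_points_def
        point_def)
next
  fix a b assume "a \<in> carrier S" "b \<in> carrier S"
  then show "semidirect_embedding (a \<otimes> b) = semidirect_embedding a
      \<otimes>\<^bsub>semidirect point_semilattice sigma_group (translation sigma_group)\<^esub> semidirect_embedding b"
    by (simp add: semidirect_def semidirect_embedding_def power_semilattice_def ideal_points_mult
        sigma_mult)
qed

lemma semidirect_embedding_inj: "inj_on semidirect_embedding (carrier S)"
proof (rule inj_onI)
  fix a b assume a: "a \<in> carrier S" and b: "b \<in> carrier S"
    and eq: "semidirect_embedding a = semidirect_embedding b"
  have "sigma_rel a b" using eq a b sigma_eq_iff by (simp add: semidirect_embedding_def)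
  moreover have "a \<otimes> a\<^sup>- = b \<otimes> b\<^sup>-"
    using eq ideal_points_plus[OF a b] ideal_points_plus[OF b a]
      idem_comm[OF mult_sinv_idem[OF a] mult_sinv_idem[OF b]]
    by (simp add: semidirect_embedding_def)
  ultimately show "a = b" using a b sigma_rel_plus_eq by blast
qed

end

lemma monoid_subsemigroup_image:
  assumes M: "monoid_subsemigroup S M u" and hom: "\<phi> \<in> hom S T" and inj: "inj_on \<phi> (carrier S)"
  shows "monoid_subsemigroup T (\<phi> ` M) (\<phi> u)"
    and "\<phi> \<in> iso (restrict_monoid S M u) (restrict_monoid T (\<phi> ` M) (\<phi> u))"
proof -
  have MS: "M \<subseteq> carrier S" using M by (simp add: monoid_subsemigroup_def)
  interpret M: monoid "restrict_monoid S M u" using M by (simp add: monoid_subsemigroup_def)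
  have mult: "\<phi> x \<otimes>\<^bsub>T\<^esub> \<phi> y = \<phi> (x \<otimes>\<^bsub>S\<^esub> y)" if "x \<in> M" "y \<in> M" for x y
    using hom MS that by (auto simp: hom_def subset_iff)
  have closed: "x \<otimes>\<^bsub>S\<^esub> y \<in> M" if "x \<in> M" "y \<in> M" for x y
    using M.m_closed that by simp
  have "monoid (restrict_monoid T (\<phi> ` M) (\<phi> u))"
    using M.m_assoc M.one_closed M.l_one M.r_one
    by (intro monoidI) (auto simp: mult closed)
  then show "monoid_subsemigroup T (\<phi> ` M) (\<phi> u)"
    using hom MS by (auto simp: monoid_subsemigroup_def hom_def)
  show "\<phi> \<in> iso (restrict_monoid S M u) (restrict_monoid T (\<phi> ` M) (\<phi> u))"
    using inj MS by (auto simp: iso_def hom_def mult bij_betw_def inj_on_subset)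
qed


section \<open>Semidirect products are \<open>E\<close>-unitary\<close>

context semilattice_action
begin

lemma act_closed [simp]: "\<lbrakk>g \<in> carrier G; y \<in> carrier Y\<rbrakk> \<Longrightarrow> \<alpha> g y \<in> carrier Y"
  using act_hom by (auto simp: hom_def)

lemma act_meet: "\<lbrakk>g \<in> carrier G; y \<in> carrier Y; z \<in> carrier Y\<rbrakk>
    \<Longrightarrow> \<alpha> g (y \<otimes>\<^bsub>Y\<^esub> z) = \<alpha> g y \<otimes>\<^bsub>Y\<^esub> \<alpha> g z"
  using act_hom by (auto simp: hom_def)

lemma act_inv [simp]: "\<lbrakk>g \<in> carrier G; y \<in> carrier Y\<rbrakk> \<Longrightarrow> \<alpha> g (\<alpha> (inv\<^bsub>G\<^esub> g) y) = y"
  by (simp flip: act_mult add: act_one)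

lemma monoid_semidirect: "monoid (semidirect Y G \<alpha>)"
  by (rule monoidI)
    (auto simp: semidirect_def act_meet act_mult act_one act_hom_one Y.m_assoc G.m_assoc)

lemma idempotents_semidirect:
  "idempotents (semidirect Y G \<alpha>) = carrier Y \<times> {\<one>\<^bsub>G\<^esub>}"
  by (auto simp: idempotents_def semidirect_def idem act_one)

lemma meet_left_idem: "\<lbrakk>y \<in> carrier Y; z \<in> carrier Y\<rbrakk> \<Longrightarrow> y \<otimes>\<^bsub>Y\<^esub> (y \<otimes>\<^bsub>Y\<^esub> z) = y \<otimes>\<^bsub>Y\<^esub> z"
  by (metis Y.m_assoc idem)

lemma is_sinv_semidirect_iff:
  assumes y: "y \<in> carrier Y" and g: "g \<in> carrier G"
  shows "is_sinv (semidirect Y G \<alpha>) (y, g) p \<longleftrightarrow> p = (\<alpha> (inv\<^bsub>G\<^esub> g) y, inv\<^bsub>G\<^esub> g)"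
proof
  assume "is_sinv (semidirect Y G \<alpha>) (y, g) p"
  then obtain z h where p: "p = (z, h)" and z: "z \<in> carrier Y" and h: "h \<in> carrier G"
    and 1: "y \<otimes>\<^bsub>Y\<^esub> \<alpha> g z \<otimes>\<^bsub>Y\<^esub> \<alpha> (g \<otimes>\<^bsub>G\<^esub> h) y = y" "g \<otimes>\<^bsub>G\<^esub> h \<otimes>\<^bsub>G\<^esub> g = g"
    and 2: "z \<otimes>\<^bsub>Y\<^esub> \<alpha> h y \<otimes>\<^bsub>Y\<^esub> \<alpha> (h \<otimes>\<^bsub>G\<^esub> g) z = z"
    by (cases p) (auto simp: is_sinv_def semidirect_def)
  have "g \<otimes>\<^bsub>G\<^esub> h = \<one>\<^bsub>G\<^esub>" using 1(2) g h by (metis G.l_cancel_one G.m_closed G.r_cancel_one)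
  then have hg: "h = inv\<^bsub>G\<^esub> g" using g h by (metis G.inv_equality G.inv_inv G.inv_closed)
  \<comment> \<open>The two defining equations say \<open>y \<le> \<alpha> g z\<close> and \<open>z \<le> \<alpha> h y\<close> in the semilattice.\<close>
  have y1: "y \<otimes>\<^bsub>Y\<^esub> \<alpha> g z = y"
    using 1(1) y z g unfolding hg
    by (simp add: act_one) (metis Y.m_assoc Y.m_comm act_closed meet_left_idem)
  have "z \<otimes>\<^bsub>Y\<^esub> \<alpha> h y = z"
    using 2 y z g h unfolding hg
    by (simp add: act_one) (metis Y.m_assoc Y.m_comm act_closed meet_left_idem G.inv_closed)
  then have "\<alpha> g z \<otimes>\<^bsub>Y\<^esub> y = \<alpha> g z"
    using act_meet[of g z "\<alpha> h y"] y z g h by (simp add: hg)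
  then have "\<alpha> g z = y" using y1 y z g by (metis Y.m_comm act_closed)
  then have "z = \<alpha> (inv\<^bsub>G\<^esub> g) y" using z g act_inv[of "inv\<^bsub>G\<^esub> g" z] by simp
  then show "p = (\<alpha> (inv\<^bsub>G\<^esub> g) y, inv\<^bsub>G\<^esub> g)" by (simp add: p hg)
next
  assume "p = (\<alpha> (inv\<^bsub>G\<^esub> g) y, inv\<^bsub>G\<^esub> g)"
  then show "is_sinv (semidirect Y G \<alpha>) (y, g) p"
    using y g by (auto simp: is_sinv_def semidirect_def idem act_one)
qed

lemma E_unitary_semidirect: "E_unitary_inverse_monoid (semidirect Y G \<alpha>)"
  unfolding E_unitary_inverse_monoid_def inverse_monoid_def inverse_monoid_axioms_def
    E_unitary_inverse_monoid_axioms_def idempotents_semidirect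
proof (intro conjI allI impI monoid_semidirect)
  fix p assume "p \<in> carrier (semidirect Y G \<alpha>)"
  then show "\<exists>!q. is_sinv (semidirect Y G \<alpha>) p q"
    by (auto simp: semidirect_def[of Y G \<alpha>, THEN arg_cong, of carrier] is_sinv_semidirect_iff)
next
  fix p q assume "p \<in> carrier (semidirect Y G \<alpha>)" "q \<in> carrier Y \<times> {\<one>\<^bsub>G\<^esub>}"
    "p \<otimes>\<^bsub>semidirect Y G \<alpha>\<^esub> q \<in> carrier Y \<times> {\<one>\<^bsub>G\<^esub>}"
  then show "p \<in> carrier Y \<times> {\<one>\<^bsub>G\<^esub>}" by (auto simp: semidirect_def)
qed

end


section \<open>Finite presentability of cyclic subacts\<close>

lemma (in left_act) generated_subact_singleton:
  assumes c: "c \<in> A"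
  shows "generated_subact S A act {c} = (\<lambda>s. act s c) ` carrier S"
proof
  have "subact S A act ((\<lambda>s. act s c) ` carrier S)"
    using c act_closed by (auto simp: subact_def simp flip: act_assoc)
  moreover have "c \<in> (\<lambda>s. act s c) ` carrier S"
    using c act_unit by (metis image_eqI one_closed)
  ultimately show "generated_subact S A act {c} \<subseteq> (\<lambda>s. act s c) ` carrier S"
    unfolding generated_subact_def by blast
qed (auto simp: generated_subact_def subact_def)

lemma (in left_act) kernel_congruence:
  assumes "c \<in> A"
  shows "act_congruence S (carrier S) (mult S)
    {(x, y) \<in> carrier S \<times> carrier S. act x c = act y c}"
  using assms
  by (auto simp: act_congruence_def act_assoc intro!: equivI refl_onI symI transI)

text \<open>Finite generation of the relations does not depend on the finite generating set. Let
  \<open>g i\<close> carry \<open>c\<close> to the \<open>i\<close>th generator of a given finite presentation, and let \<open>d\<close> carry the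
  \<open>j\<close>th generator back to \<open>c\<close>. Then the kernel is generated by the relations of the presentation,
  rewritten in terms of \<open>c\<close>, together with the single relation that identifies \<open>\<one>\<close> with
  \<open>d \<otimes> g j\<close>.\<close>

lemma (in left_act) fg_kernel_if_fp_cyclic:
  assumes c: "c \<in> A" and fp: "fp_act S (generated_subact S A act {c}) act"
  shows "fg_congruence S (carrier S) (mult S)
    {(x, y) \<in> carrier S \<times> carrier S. act x c = act y c}"
    (is "fg_congruence _ _ _ ?K")
proof -
  let ?B = "generated_subact S A act {c}"
  have B: "?B = (\<lambda>s. act s c) ` carrier S" using c by (rule generated_subact_singleton)
  obtain X :: "nat set" and \<rho> h where X: "finite X"
    and \<rho>: "fg_congruence S (carrier S \<times> X) (free_act S) \<rho>"
    and h: "act_iso S ?B act ((carrier S \<times> X) // \<rho>) (quotient_act \<rho> (free_act S)) h"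
    using fp unfolding fp_act_def by blast
  obtain H where H: "finite H" "H \<subseteq> (carrier S \<times> X) \<times> (carrier S \<times> X)"
    and \<rho>H: "\<rho> = generated_congruence S (carrier S \<times> X) (free_act S) H"
    using \<rho> by (auto simp: fg_congruence_def)
  have cong: "act_congruence S (carrier S \<times> X) (free_act S) \<rho>"
    unfolding \<rho>H using left_act_free[OF monoid_axioms] H(2) by (rule act_congruence_generated)
  then have eqv: "equiv (carrier S \<times> X) \<rho>" by (simp add: act_congruence_def)
  have H\<rho>: "H \<subseteq> \<rho>" by (auto simp: \<rho>H generated_congruence_def)
  have bij: "bij_betw h ?B ((carrier S \<times> X) // \<rho>)" using h by (simp add: act_iso_def)
  have h_act: "h (act s x) = quotient_act \<rho> (free_act S) s (h x)"
    if "s \<in> carrier S" "x \<in> ?B" for s x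
    using h that unfolding act_iso_def by blast
  have inj: "act s c = act t c"
    if "s \<in> carrier S" "t \<in> carrier S" "h (act s c) = h (act t c)" for s t
  proof -
    have "act s c \<in> ?B" "act t c \<in> ?B" using that by (simp_all add: B)
    then show ?thesis using bij that(3) unfolding bij_betw_def by (blast dest: inj_onD)
  qed
  have "\<exists>g. g \<in> carrier S \<and> h (act g c) = \<rho> `` {(\<one>, i)}" if "i \<in> X" for i
  proof -
    have "\<rho> `` {(\<one>, i)} \<in> (carrier S \<times> X) // \<rho>" using that by (intro quotientI) simp
    then have "\<rho> `` {(\<one>, i)} \<in> h ` ?B" using bij by (simp add: bij_betw_def)
    then show ?thesis by (auto simp: B)
  qed
  then obtain g where g: "\<And>i. i \<in> X \<Longrightarrow> g i \<in> carrier S"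
    and hg1: "\<And>i. i \<in> X \<Longrightarrow> h (act (g i) c) = \<rho> `` {(\<one>, i)}"
    by metis
  have hg: "h (act (s \<otimes> g i) c) = \<rho> `` {(s, i)}" if "s \<in> carrier S" "i \<in> X" for s i
    using that g[of i] c
    by (simp add: act_assoc h_act B hg1 quotient_act_class[OF cong] free_act_def)
  have cB: "c \<in> ?B" by (auto simp: generated_subact_def)
  then have "h c \<in> (carrier S \<times> X) // \<rho>" using bij by (auto simp: bij_betw_def)
  then obtain d j where d: "d \<in> carrier S" and j: "j \<in> X" and hc: "h c = \<rho> `` {(d, j)}"
    by (auto elim!: quotientE)
  let ?F = "\<lambda>((s, i), (t, k)). (s \<otimes> g i, t \<otimes> g k)"
  let ?H = "insert (\<one>, d \<otimes> g j) (?F ` H)"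
  have HK: "?H \<subseteq> ?K"
  proof -
    have "act \<one> c = act (d \<otimes> g j) c"
      using inj[of \<one> "d \<otimes> g j"] hc hg[OF d j] d j g c by (simp add: act_unit)
    moreover have "act (s \<otimes> g i) c = act (t \<otimes> g k) c" if "((s, i), (t, k)) \<in> H" for s i t k
    proof -
      have st: "s \<in> carrier S" "i \<in> X" "t \<in> carrier S" "k \<in> X" using that H(2) by auto
      have "((s, i), (t, k)) \<in> \<rho>" using that H\<rho> by blast
      then have "\<rho> `` {(s, i)} = \<rho> `` {(t, k)}" by (rule equiv_class_eq[OF eqv])
      then show ?thesis using st g by (intro inj) (auto simp: hg)
    qed
    ultimately show ?thesis using d j g H(2) by fastforce
  qed
  have "?K = generated_congruence S (carrier S) (mult S) ?H"
  proof
    show "generated_congruence S (carrier S) (mult S) ?H \<subseteq> ?K"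
      using HK kernel_congruence[OF c] unfolding generated_congruence_def by blast
    have "(x, y) \<in> \<theta>" if \<theta>: "act_congruence S (carrier S) (mult S) \<theta>" "?H \<subseteq> \<theta>"
      and xy: "x \<in> carrier S" "y \<in> carrier S" "act x c = act y c" for \<theta> x y
    proof -
      have \<theta>e: "equiv (carrier S) \<theta>" using \<theta>(1) by (simp add: act_congruence_def)
      have \<theta>m: "(s \<otimes> p, s \<otimes> q) \<in> \<theta>" if "s \<in> carrier S" "(p, q) \<in> \<theta>" for s p q
        using \<theta>(1) that by (auto simp: act_congruence_def)
      \<comment> \<open>Pull \<open>\<theta>\<close> back along the map from the free act that sends \<open>(s, i)\<close> to \<open>s \<otimes> g i\<close>.\<close>
      let ?P = "{((s, i), (t, k)). s \<in> carrier S \<and> t \<in> carrier S \<and> i \<in> X \<and> k \<in> X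
        \<and> (s \<otimes> g i, t \<otimes> g k) \<in> \<theta>}"
      have "equiv (carrier S \<times> X) ?P"
      proof (rule equivI)
        show "refl_on (carrier S \<times> X) ?P"
          using \<theta>e g by (auto simp: refl_on_def equiv_def)
        show "sym ?P" using \<theta>e by (auto simp: sym_def equiv_def)
        show "trans ?P" using \<theta>e unfolding trans_def equiv_def by fast
      qed auto
      then have "act_congruence S (carrier S \<times> X) (free_act S) ?P"
        using \<theta>m g by (auto simp: act_congruence_def free_act_def m_assoc)
      moreover have "H \<subseteq> ?P" using H(2) \<theta>(2) by auto
      ultimately have \<rho>P: "\<rho> \<subseteq> ?P" unfolding \<rho>H generated_congruence_def by blast
      have "h (act (x \<otimes> d \<otimes> g j) c) = h (act (y \<otimes> d \<otimes> g j) c)"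
      proof -
        have "h (act (s \<otimes> d \<otimes> g j) c) = h (act s c)" if "s \<in> carrier S" for s
          using that d j c cB hc
          by (simp add: hg h_act[OF _ cB] quotient_act_class[OF cong] free_act_def)
        then show ?thesis using xy by simp
      qed
      then have "\<rho> `` {(x \<otimes> d, j)} = \<rho> `` {(y \<otimes> d, j)}" using xy d j by (simp add: hg)
      then have "((x \<otimes> d, j), (y \<otimes> d, j)) \<in> \<rho>"
        using eqv xy d j by (simp add: eq_equiv_class_iff)
      then have "(x \<otimes> d \<otimes> g j, y \<otimes> d \<otimes> g j) \<in> \<theta>" using \<rho>P by auto
      moreover have "(s, s \<otimes> d \<otimes> g j) \<in> \<theta>" if "s \<in> carrier S" for s
        using \<theta>m[of s \<one> "d \<otimes> g j"] \<theta>(2) that d j g by (simp add: m_assoc)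
      ultimately show ?thesis using xy \<theta>e by (meson equivE symD transD)
    qed
    then show "?K \<subseteq> generated_congruence S (carrier S) (mult S) ?H"
      unfolding generated_congruence_def by blast
  qed
  moreover have "finite ?H" using H(1) by simp
  moreover have "?H \<subseteq> carrier S \<times> carrier S" using HK by (rule subset_trans) blast
  ultimately show ?thesis unfolding fg_congruence_def by (intro exI[of _ ?H] conjI)
qed

text \<open>Transitivity of the explicit relation holds because powers of \<open>a\<close> commute, and each \<open>s\<close> is
  congruent to all \<open>s \<otimes> a [^] m\<close>.\<close>

lemma (in monoid) congruence_collapsing_powers:
  fixes i :: 'i
  assumes a: "a \<in> carrier G"
  shows "generated_congruence G (carrier G \<times> {i}) (free_act G) {((a, i), (\<one>, i))}
    = {((s, j), (t, k)). s \<in> carrier G \<and> t \<in> carrier G \<and> j = i \<and> k = i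
        \<and> (\<exists>(m :: nat) (n :: nat). s \<otimes> a [^] m = t \<otimes> a [^] n)}"
    (is "?C = ?R")
proof
  have "trans ?R"
  proof (rule transI, clarsimp)
    fix s t r and m n p q :: nat
    assume c: "s \<in> carrier G" "t \<in> carrier G" "r \<in> carrier G"
      and 1: "s \<otimes> a [^] m = t \<otimes> a [^] n" and 2: "t \<otimes> a [^] p = r \<otimes> a [^] q"
    have "s \<otimes> a [^] (m + p) = s \<otimes> a [^] m \<otimes> a [^] p"
      using c a by (simp add: m_assoc nat_pow_mult)
    also have "\<dots> = t \<otimes> a [^] p \<otimes> a [^] n"
      unfolding 1 using c a by (simp add: m_assoc nat_pow_mult add.commute)
    also have "\<dots> = r \<otimes> a [^] (q + n)"
      unfolding 2 using c a by (simp add: m_assoc nat_pow_mult)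
    finally show "\<exists>(m :: nat) (n :: nat). s \<otimes> a [^] m = r \<otimes> a [^] n" by blast
  qed
  moreover have "refl_on (carrier G \<times> {i}) ?R" by (auto simp: refl_on_def)
  moreover have "sym ?R" unfolding sym_def by (clarsimp, metis)
  ultimately have R_equiv: "equiv (carrier G \<times> {i}) ?R" by (intro equivI) auto
  have R_act: "(free_act G r p, free_act G r q) \<in> ?R"
    if r: "r \<in> carrier G" and pq: "(p, q) \<in> ?R" for r p q
  proof -
    obtain s t m n where st: "s \<in> carrier G" "t \<in> carrier G" "p = (s, i)" "q = (t, i)"
      and eq: "s \<otimes> a [^] (m :: nat) = t \<otimes> a [^] (n :: nat)"
      using pq by auto
    have "r \<otimes> s \<otimes> a [^] m = r \<otimes> t \<otimes> a [^] n"
      using r st a eq by (simp add: m_assoc)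
    then show ?thesis using r st by (auto simp: free_act_def)
  qed
  have "act_congruence G (carrier G \<times> {i}) (free_act G) ?R"
    unfolding act_congruence_def
  proof (intro conjI ballI R_equiv)
    fix r pq assume "r \<in> carrier G" "pq \<in> ?R"
    then show "case pq of (p, q) \<Rightarrow> (free_act G r p, free_act G r q) \<in> ?R"
      using R_act[of r "fst pq" "snd pq"] by (simp only: prod.collapse case_prod_beta)
  qed
  moreover have "((a, i), (\<one>, i)) \<in> ?R"
  proof -
    have "a \<otimes> a [^] (0 :: nat) = \<one> \<otimes> a [^] (1 :: nat)" using a by simp
    then show ?thesis using a by blast
  qed
  ultimately show "?C \<subseteq> ?R" unfolding generated_congruence_def by blast
next
  have "act_congruence G (carrier G \<times> {i}) (free_act G) ?C"
    using a by (intro act_congruence_generated left_act_free monoid_axioms) auto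
  then have C: "equiv (carrier G \<times> {i}) ?C"
    and Cm: "\<And>s p q. \<lbrakk>s \<in> carrier G; (p, q) \<in> ?C\<rbrakk> \<Longrightarrow> (free_act G s p, free_act G s q) \<in> ?C"
    unfolding act_congruence_def by blast+
  have gen: "((a, i), (\<one>, i)) \<in> ?C" by (auto simp: generated_congruence_def)
  have pow: "((s \<otimes> a [^] n, i), (s, i)) \<in> ?C" if s: "s \<in> carrier G" for s and n :: nat
  proof (induction n)
    case 0
    then show ?case using C s by (auto simp: equiv_def refl_on_def)
  next
    case (Suc n)
    have "((s \<otimes> a [^] n \<otimes> a, i), (s \<otimes> a [^] n, i)) \<in> ?C"
      using Cm[OF _ gen, of "s \<otimes> a [^] n"] s a by (simp add: free_act_def)
    then have "((s \<otimes> a [^] Suc n, i), (s \<otimes> a [^] n, i)) \<in> ?C"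
      using s a by (simp add: m_assoc)
    then show ?case using Suc C by (meson equivE transD)
  qed
  show "?R \<subseteq> ?C"
  proof clarify
    fix s t and m n :: nat
    assume st: "s \<in> carrier G" "t \<in> carrier G" and eq: "s \<otimes> a [^] m = t \<otimes> a [^] n"
    have "((s \<otimes> a [^] m, i), (s, i)) \<in> ?C" using st(1) by (rule pow)
    moreover have "((s \<otimes> a [^] m, i), (t, i)) \<in> ?C" unfolding eq using st(2) by (rule pow)
    ultimately show "((s, i), (t, i)) \<in> ?C" using C by (meson equivE symD transD)
  qed
qed

text \<open>The relation is the kernel of \<open>x \<mapsto> x \<cdot> [b]\<close> into the cyclic act with one generator
  and the defining relation \<open>a = \<one>\<close>.\<close>

lemma (in monoid) fg_annihilator_if_left_coherent:
  assumes coh: "left_coherent G" and a: "a \<in> carrier G" and b: "b \<in> carrier G"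
  shows "fg_congruence G (carrier G) (mult G) {(x, y) \<in> carrier G \<times> carrier G.
    \<exists>(m :: nat) (n :: nat). x \<otimes> (b \<otimes> a [^] m) = y \<otimes> (b \<otimes> a [^] n)}"
    (is "fg_congruence _ _ _ ?K")
proof -
  let ?A = "carrier G \<times> {0 :: nat}"
  define \<rho> where "\<rho> = generated_congruence G ?A (free_act G) {((a, 0), (\<one>, 0))}"
  let ?Q = "?A // \<rho>" and ?q = "quotient_act \<rho> (free_act G)" and ?c = "\<rho> `` {(b, 0)}"
  have cong: "act_congruence G ?A (free_act G) \<rho>"
    unfolding \<rho>_def using a by (intro act_congruence_generated left_act_free monoid_axioms) auto
  then have eqv: "equiv ?A \<rho>" by (simp add: act_congruence_def)
  have Q: "left_act G ?Q ?q"
    by (rule left_act_quotient[OF left_act_free[OF monoid_axioms] cong])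
  have "fg_congruence G ?A (free_act G) \<rho>"
    unfolding fg_congruence_def \<rho>_def using a by (intro exI[of _ "{((a, 0), (\<one>, 0))}"]) auto
  moreover have "act_iso G ?Q ?q ?Q ?q id" by (simp add: act_iso_def)
  ultimately have "fp_act G ?Q ?q"
    unfolding fp_act_def using Q by (intro conjI exI[of _ "{0}"] exI[of _ \<rho>] exI[of _ id]) auto
  moreover have c: "?c \<in> ?Q" using b by (intro quotientI) simp
  then have "fg_subact G ?Q ?q (generated_subact G ?Q ?q {?c})"
    unfolding fg_subact_def by blast
  ultimately have "fp_act G (generated_subact G ?Q ?q {?c}) ?q"
    using coh unfolding left_coherent_def by blast
  then have "fg_congruence G (carrier G) (mult G)
      {(x, y) \<in> carrier G \<times> carrier G. ?q x ?c = ?q y ?c}"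
    by (rule left_act.fg_kernel_if_fp_cyclic[OF Q c])
  moreover have "?q x ?c = ?q y ?c \<longleftrightarrow> (\<exists>(m :: nat) (n :: nat). x \<otimes> (b \<otimes> a [^] m) = y \<otimes> (b \<otimes> a [^] n))"
    if "x \<in> carrier G" "y \<in> carrier G" for x y
  proof -
    have "?q z ?c = \<rho> `` {(z \<otimes> b, 0)}" if "z \<in> carrier G" for z
      using that b by (simp add: quotient_act_class[OF cong] free_act_def)
    then have "?q x ?c = ?q y ?c \<longleftrightarrow> ((x \<otimes> b, 0), (y \<otimes> b, 0)) \<in> \<rho>"
      using that b eqv by (simp add: eq_equiv_class_iff)
    then show ?thesis
      unfolding \<rho>_def congruence_collapsing_powers[OF a] using that a b by (simp add: m_assoc)
  qed
  then have "{(x, y) \<in> carrier G \<times> carrier G. ?q x ?c = ?q y ?c} = ?K" by blast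
  ultimately show ?thesis by simp
qed


section \<open>Non-coherence\<close>

text \<open>Related elements agree on membership in \<open>T\<close>, by the case \<open>t = \<one>\<close>. Hence pairs inside this
  left congruence generate no pair that is separated by \<open>T\<close>.\<close>

lemma (in monoid) syntactic_congruence:
  "act_congruence G (carrier G) (mult G)
    {(x, y) \<in> carrier G \<times> carrier G. \<forall>t\<in>carrier G. t \<otimes> x \<in> T \<longleftrightarrow> t \<otimes> y \<in> T}"
  by (auto simp: act_congruence_def simp flip: m_assoc intro!: equivI refl_onI symI transI)

context E_unitary_inverse_monoid
begin

lemma le_L_mult: "\<lbrakk>x \<in> carrier S; z \<in> carrier S\<rbrakk> \<Longrightarrow> le_L S (z \<otimes> x) x"
  by (auto simp: le_L_def r_coset_def simp flip: m_assoc)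

text \<open>As \<open>t \<otimes> z\<close> is the product of the idempotents \<open>t \<otimes> t\<^sup>-\<close> and \<open>z\<^sup>- \<otimes> z\<close>, both of these
  fix \<open>b \<otimes> a [^] N\<close>. Multiplying the equation by \<open>a [^] (N - m)\<close> therefore bounds
  \<open>b \<otimes> a [^] N\<close> in the \<open>\<L>\<close>-order by \<open>b \<otimes> a [^] (n + (N - m))\<close>, and incomparability forces
  \<open>n = m\<close>. Then the transfer lemmas apply with \<open>b \<otimes> a [^] N\<close> as the common factor.\<close>

lemma idem_fixing_transfer:
  fixes m n N :: nat
  assumes c: "t \<in> carrier S" "z \<in> carrier S" "z' \<in> carrier S" "a \<in> carrier S" "b \<in> carrier S"
    and incomparable: "\<And>(i :: nat) (j :: nat). i \<noteq> j \<Longrightarrow> \<not> le_L S (b \<otimes> a [^] i) (b \<otimes> a [^] j)"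
    and eq: "z \<otimes> (b \<otimes> a [^] m) = z' \<otimes> (b \<otimes> a [^] n)" and m: "m \<le> N"
    and tz: "t \<otimes> z \<in> E" and tz_fix: "t \<otimes> z \<otimes> (b \<otimes> a [^] N) = b \<otimes> a [^] N"
  shows "t \<otimes> z' \<in> E \<and> t \<otimes> z' \<otimes> (b \<otimes> a [^] N) = b \<otimes> a [^] N"
proof -
  let ?p = "plus_idem S t" and ?s = "star_idem S z" and ?c = "b \<otimes> a [^] N"
  have cc: "?c \<in> carrier S" using c by simp
  have p: "?p \<in> E" and s: "?s \<in> E" using c by (simp_all add: plus_idem_def star_idem_def)
  have ps: "?p \<otimes> (?s \<otimes> ?c) = ?c"
    using tz_fix idem_product[OF c(1,2) tz] p s cc by (simp add: m_assoc)
  have "?s \<otimes> ?c = ?s \<otimes> (?p \<otimes> (?s \<otimes> ?c))" by (simp only: ps)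
  also have "\<dots> = ?p \<otimes> (?s \<otimes> ?c)" using p s cc by (simp add: idem_left_comm[of ?s ?p])
  finally have s_fix: "?s \<otimes> ?c = ?c" by (simp only: ps)
  have p_fix: "?p \<otimes> ?c = ?c" using ps unfolding s_fix .
  have "a [^] m \<otimes> a [^] (N - m) = a [^] N" using c m by (simp add: nat_pow_mult)
  then have zN: "z \<otimes> ?c = z' \<otimes> (b \<otimes> a [^] (n + (N - m)))"
    using arg_cong[OF eq, of "\<lambda>v. v \<otimes> a [^] (N - m)"] c by (simp add: m_assoc nat_pow_mult)
  have "n = m"
  proof (rule ccontr)
    assume "n \<noteq> m"
    have "?c = z\<^sup>- \<otimes> (z \<otimes> ?c)" using s_fix c cc by (simp add: star_idem_def m_assoc)
    also have "\<dots> = z\<^sup>- \<otimes> z' \<otimes> (b \<otimes> a [^] (n + (N - m)))"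
      unfolding zN using c by (simp add: m_assoc)
    finally have "le_L S ?c (b \<otimes> a [^] (n + (N - m)))"
      using le_L_mult[of "b \<otimes> a [^] (n + (N - m))" "z\<^sup>- \<otimes> z'"] c by simp
    moreover have "N \<noteq> n + (N - m)" using \<open>n \<noteq> m\<close> m by simp
    ultimately show False using incomparable by blast
  qed
  then have zc: "z \<otimes> ?c = z' \<otimes> ?c" using zN m by simp
  have tz': "t \<otimes> z' \<in> E" using idem_product_transfer[OF c(1-3) cc tz zc] .
  have "star_idem S z' \<otimes> ?c = ?c" using star_fixes_transfer[OF c(2,3) cc zc s_fix] .
  then have "t \<otimes> z' \<otimes> ?c = ?c"
    unfolding idem_product[OF c(1,3) tz'] using p_fix p c cc by (simp add: star_idem_def m_assoc)
  with tz' show ?thesis by simp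
qed

lemma not_left_coherent:
  assumes M: "monoid_subsemigroup S M u" and a: "a \<in> M" and b: "b \<in> M"
    and e: "\<And>i :: nat. 1 \<le> i \<Longrightarrow> e i \<in> M"
    and incomparable: "\<And>(i :: nat) (j :: nat). i \<noteq> j \<Longrightarrow> \<not> le_L S (b \<otimes> a [^] i) (b \<otimes> a [^] j)"
    and fix_i: "\<And>i :: nat. 1 \<le> i \<Longrightarrow> e i \<otimes> (b \<otimes> a [^] i) = b \<otimes> a [^] i"
    and move: "\<And>i :: nat. 1 \<le> i \<Longrightarrow> e i \<otimes> (b \<otimes> a [^] (i - 1)) \<noteq> b \<otimes> a [^] (i - 1)"
  shows "\<not> left_coherent (restrict_monoid S M u)"
proof
  let ?M = "restrict_monoid S M u"
  assume coh: "left_coherent ?M"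
  interpret M: monoid ?M using M by (simp add: monoid_subsemigroup_def)
  have MS: "x \<in> carrier S" if "x \<in> M" for x using M that by (auto simp: monoid_subsemigroup_def)
  have MM: "x \<otimes> y \<in> M" if "x \<in> M" "y \<in> M" for x y using M.m_closed that by simp
  have ux: "u \<otimes> x = x" if "x \<in> M" for x using M.l_one that by simp
  have uM: "u \<in> M" using M.one_closed by simp
  \<comment> \<open>The zeroth powers in \<open>M\<close> and in the whole monoid may differ, but not after multiplication
    by an element of \<open>M\<close>.\<close>
  have pow: "x \<otimes> a [^]\<^bsub>?M\<^esub> n = x \<otimes> a [^] n" if x: "x \<in> M" for x and n :: nat
  proof (induction n)
    case 0
    show ?case using M.r_one x MS by simp
  next
    case (Suc n)
    have "a [^]\<^bsub>?M\<^esub> n \<in> M" using M.nat_pow_closed[of a n] a by simp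
    then have "x \<otimes> a [^]\<^bsub>?M\<^esub> Suc n = x \<otimes> a [^]\<^bsub>?M\<^esub> n \<otimes> a" using x a MS by (simp add: m_assoc)
    then show ?case using x a MS Suc by (simp add: m_assoc)
  qed
  have bpow: "b \<otimes> a [^] n \<in> M" for n :: nat
    using MM[OF b, of "a [^]\<^bsub>?M\<^esub> n"] M.nat_pow_closed[of a n] a by (simp add: pow[OF b])
  define K where "K = {(x, y) \<in> M \<times> M. \<exists>(m :: nat) (n :: nat). x \<otimes> (b \<otimes> a [^] m) = y \<otimes> (b \<otimes> a [^] n)}"
  have "fg_congruence ?M M (mult S) K"
    using M.fg_annihilator_if_left_coherent[OF coh, of a b] a b pow[OF b] by (simp add: K_def)
  then obtain H where H: "finite H" and KH: "K = generated_congruence ?M M (mult S) H"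
    by (auto simp: fg_congruence_def)
  have HK: "H \<subseteq> K" unfolding KH generated_congruence_def by blast
  then have "\<forall>h\<in>H. \<exists>(m :: nat) (n :: nat). fst h \<otimes> (b \<otimes> a [^] m) = snd h \<otimes> (b \<otimes> a [^] n)"
    by (auto simp: K_def)
  then obtain f g :: "'a \<times> 'a \<Rightarrow> nat"
    where fg: "\<And>h. h \<in> H \<Longrightarrow> fst h \<otimes> (b \<otimes> a [^] f h) = snd h \<otimes> (b \<otimes> a [^] g h)"
    by metis
  \<comment> \<open>All exponents that witness membership of \<open>H\<close> in \<open>K\<close> are bounded by \<open>N\<close>.\<close>
  obtain N where "\<forall>k\<in>f ` H \<union> g ` H. k \<le> N"
    using H finite_nat_set_iff_bounded_le[of "f ` H \<union> g ` H"] by auto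
  then have N: "f h \<le> N" "g h \<le> N" if "h \<in> H" for h using that by auto
  define T where "T = {s \<in> E. s \<otimes> (b \<otimes> a [^] N) = b \<otimes> a [^] N}"
  define \<theta> where "\<theta> = {(x, y) \<in> M \<times> M. \<forall>t\<in>M. t \<otimes> x \<in> T \<longleftrightarrow> t \<otimes> y \<in> T}"
  have "H \<subseteq> \<theta>"
  proof
    fix h assume h: "h \<in> H"
    obtain z z' where zz: "h = (z, z')" by (cases h)
    have z: "z \<in> M" "z' \<in> M" using h HK by (auto simp: zz K_def)
    have eq: "z \<otimes> (b \<otimes> a [^] f h) = z' \<otimes> (b \<otimes> a [^] g h)" using fg[OF h] by (simp add: zz)
    have "t \<otimes> z' \<in> T" if "t \<in> M" "t \<otimes> z \<in> T" for t
      using idem_fixing_transfer[OF MS MS MS MS MS incomparable eq N(1)[OF h], of t] that z a b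
      by (simp add: T_def)
    moreover have "t \<otimes> z \<in> T" if "t \<in> M" "t \<otimes> z' \<in> T" for t
      using idem_fixing_transfer[OF MS MS MS MS MS incomparable eq[symmetric] N(2)[OF h], of t]
        that z a b
      by (simp add: T_def)
    ultimately show "h \<in> \<theta>" using z unfolding zz \<theta>_def by blast
  qed
  moreover have "act_congruence ?M M (mult S) \<theta>"
    using M.syntactic_congruence[of T] by (simp add: \<theta>_def)
  ultimately have "K \<subseteq> \<theta>" unfolding KH generated_congruence_def by blast
  moreover have "(u, e (Suc N)) \<in> K"
  proof -
    have "u \<otimes> (b \<otimes> a [^] Suc N) = e (Suc N) \<otimes> (b \<otimes> a [^] Suc N)"
      unfolding ux[OF bpow] using fix_i[of "Suc N"] by simp
    moreover have "e (Suc N) \<in> M" using e by simp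
    ultimately show ?thesis unfolding K_def using uM by blast
  qed
  ultimately have "u \<otimes> u \<in> T \<longleftrightarrow> u \<otimes> e (Suc N) \<in> T" using uM by (auto simp: \<theta>_def)
  moreover have "u \<otimes> u \<in> T"
    using uM ux[OF uM] ux[OF bpow[of N]] MS by (auto simp: T_def intro: idemI)
  moreover have "u \<otimes> e (Suc N) \<notin> T"
    using ux[OF e[of "Suc N"]] move[of "Suc N"] by (simp add: T_def)
  ultimately show False by blast
qed

end

theorem corollary4p10:
  fixes F :: "('f, 'r) monoid_scheme" (structure) and M :: "'f set" and u :: 'f
  assumes F: "E_unitary_inverse_monoid F"
    and M: "monoid_subsemigroup F M u"
  shows
    "(\<exists>(Y :: ('f set \<times> 'f) set monoid) (G :: 'f set monoid) \<alpha> N v \<phi>.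
        semilattice_action Y G \<alpha> \<and> monoid_subsemigroup (semidirect Y G \<alpha>) N v \<and>
        \<phi> \<in> iso (restrict_monoid F M u) (restrict_monoid (semidirect Y G \<alpha>) N v))
   \<and> (\<forall>(Y :: 'y monoid) (G :: 'g monoid) \<alpha>.
        semilattice_action Y G \<alpha> \<longrightarrow> E_unitary_inverse_monoid (semidirect Y G \<alpha>))
   \<and> (\<forall>t\<in>M. \<forall>x\<in>M. t \<otimes> x \<in> idempotents F \<longrightarrow> t \<otimes> x = plus_idem F t \<otimes> star_idem F x)
   \<and> (\<forall>t\<in>M. \<forall>x\<in>M. \<forall>y\<in>M. \<forall>w\<in>M.
        t \<otimes> x \<in> idempotents F \<longrightarrow> x \<otimes> w = y \<otimes> w \<longrightarrow> t \<otimes> y \<in> idempotents F)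
   \<and> (\<forall>a\<in>M. \<forall>b\<in>M. \<forall>i::nat. \<forall>x\<in>M. \<forall>y\<in>M.
        x \<otimes> (b \<otimes> a [^] i) = y \<otimes> (b \<otimes> a [^] i) \<longrightarrow>
        star_idem F x \<otimes> (b \<otimes> a [^] i) = b \<otimes> a [^] i \<longrightarrow>
        star_idem F y \<otimes> (b \<otimes> a [^] i) = b \<otimes> a [^] i)
   \<and> (\<forall>a\<in>M. \<forall>b\<in>M. \<forall>e :: nat \<Rightarrow> 'f.
        (\<forall>i\<ge>1. e i \<in> idempotents (restrict_monoid F M u)) \<longrightarrow>
        (\<forall>i j::nat. i \<noteq> j \<longrightarrow> \<not> le_L F (b \<otimes> a [^] i) (b \<otimes> a [^] j)) \<longrightarrow>
        (\<forall>i\<ge>1. e i \<otimes> (b \<otimes> a [^] i) = b \<otimes> a [^] i \<and>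
                e i \<otimes> (b \<otimes> a [^] (i - 1)) \<noteq> b \<otimes> a [^] (i - 1)) \<longrightarrow>
        \<not> left_coherent (restrict_monoid F M u))"
proof (intro conjI allI ballI impI)
  interpret F: E_unitary_inverse_monoid F by (rule F)
  have MF: "x \<in> carrier F" if "x \<in> M" for x using M that by (auto simp: monoid_subsemigroup_def)
  show "\<exists>(Y :: ('f set \<times> 'f) set monoid) (G :: 'f set monoid) \<alpha> N v \<phi>.
      semilattice_action Y G \<alpha> \<and> monoid_subsemigroup (semidirect Y G \<alpha>) N v \<and>
      \<phi> \<in> iso (restrict_monoid F M u) (restrict_monoid (semidirect Y G \<alpha>) N v)"
    using semilattice_action_translation[OF F.group_sigma_group, of "carrier F"]
      monoid_subsemigroup_image[OF M F.semidirect_embedding_hom F.semidirect_embedding_inj]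
    by blast
  show "E_unitary_inverse_monoid (semidirect Y G \<alpha>)" if "semilattice_action Y G \<alpha>"
    for Y :: "'y monoid" and G :: "'g monoid" and \<alpha>
    using that by (rule semilattice_action.E_unitary_semidirect)
  show "t \<otimes> x = plus_idem F t \<otimes> star_idem F x"
    if "t \<in> M" "x \<in> M" "t \<otimes> x \<in> idempotents F" for t x
    using that MF by (intro F.idem_product)
  show "t \<otimes> y \<in> idempotents F"
    if "t \<in> M" "x \<in> M" "y \<in> M" "w \<in> M" "t \<otimes> x \<in> idempotents F" "x \<otimes> w = y \<otimes> w" for t x y w
    using F.idem_product_transfer[OF MF MF MF MF] that by blast
  show "star_idem F y \<otimes> (b \<otimes> a [^] i) = b \<otimes> a [^] i"
    if "a \<in> M" "b \<in> M" "x \<in> M" "y \<in> M" "x \<otimes> (b \<otimes> a [^] i) = y \<otimes> (b \<otimes> a [^] i)"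
      "star_idem F x \<otimes> (b \<otimes> a [^] i) = b \<otimes> a [^] i" for a b x y and i :: nat
    using F.star_fixes_transfer[OF MF MF, of x y "b \<otimes> a [^] i"] that MF by simp
  fix a b and e :: "nat \<Rightarrow> 'f"
  assume ab: "a \<in> M" "b \<in> M"
    and e: "\<forall>i\<ge>1. e i \<in> idempotents (restrict_monoid F M u)"
    and incomparable: "\<forall>i j::nat. i \<noteq> j \<longrightarrow> \<not> le_L F (b \<otimes> a [^] i) (b \<otimes> a [^] j)"
    and fix_move: "\<forall>i\<ge>1. e i \<otimes> (b \<otimes> a [^] i) = b \<otimes> a [^] i \<and>
      e i \<otimes> (b \<otimes> a [^] (i - 1)) \<noteq> b \<otimes> a [^] (i - 1)"
  show "\<not> left_coherent (restrict_monoid F M u)"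
  proof (rule F.not_left_coherent[OF M ab])
    show "e i \<in> M" if "1 \<le> i" for i
      using e that unfolding idempotents_def by simp
  qed (use incomparable fix_move in blast)+
qed

end
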